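(* Let $F:\mathbb{R}^n\rightrightarrows\mathbb{R}^n$ be a multifunction satisfying (F1)-(F3) of the context, with bilateral minimal time function $T$ and Hamiltonian $h$. Let $(\alpha,\beta)\in\mathbb{R}^n\times\mathbb{R}^n$ be such that $0<r:=T(\alpha,\beta)<+\infty$. Then: (i) If $(\zeta,\theta)\in\widehat{N}_{\mathcal{R}(r)}(\alpha,\beta)$, then $h(\alpha,\zeta)=h(\beta,-\theta)$ and $((\zeta,\theta),h(\alpha,\zeta))\in\widehat{N}_{\mathrm{epi}(T)}((\alpha,\beta),r)$. (ii) If $(\zeta,\theta)\in\mathbb{R}^n\times\mathbb{R}^n$ and $\lambda\in\mathbb{R}$ satisfy $((\zeta,\theta),\lambda)\in\widehat{N}_{\mathrm{epi}(T)}((\alpha,\beta),r)$, then $\lambda\le 0$, $h(\alpha,\zeta)=h(\beta,-\theta)=\lambda$, and $(\zeta,\theta)\in\widehat{N}_{\mathcal{R}(r)}(\alpha,\beta)$.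
   Context: $\|\cdot\|$ and $\langle\cdot,\cdot\rangle$ denote the Euclidean norm and inner product (also on product spaces), and $\bar B$ the closed unit ball of $\mathbb{R}^n$. Assumptions on $F:\mathbb{R}^n\rightrightarrows\mathbb{R}^n$: (F1) $F(x)$ is nonempty, compact and convex for every $x\in\mathbb{R}^n$. (F2) $F$ is locally Lipschitz: for every compact set $K\subset\mathbb{R}^n$ there is a constant $L=L(K)$ such that $F(x)\subset F(y)+L\|y-x\|\bar B$ for all $x,y\in K$. (F3) There are positive constants $\gamma,c$ such that for all $x\in\mathbb{R}^n$, $v\in F(x)$ implies $\|v\|\le\gamma\|x\|+c$. A trajectory of $F$ is an absolutely continuous function $x(\cdot)$ with $\dot x(t)\in F(x(t))$ for a.e. $t$ in its interval of definition. The bilateral minimal time function $T:\mathbb{R}^n\times\mathbb{R}^n\to[0,+\infty]$ is $T(\alpha,\beta)=\inf\{\tau\ge 0:\text{ there is a trajectory }x(\cdot)\text{ of }F\text{ on }[0,\tau]\text{ with }x(0)=\alpha,\ x(\tau)=\beta\}$, with $T(\alpha,\beta)=+\infty$ if there is no such trajectory. The Hamiltonian is $h(x,p)=\min_{v\in F(x)}\langle v,p\rangle$ for $(x,p)\in\mathbb{R}^n\times\mathbb{R}^n$. For $t>0$, $\mathcal{R}(t)=\{(x,y)\in\mathbb{R}^n\times\mathbb{R}^n: T(x,y)\le t\}$. The epigraph is $\mathrm{epi}(T)=\{((x,y),\mu)\in(\mathbb{R}^n\times\mathbb{R}^n)\times\mathbb{R}: T(x,y)<+\infty,\ \mu\ge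 T(x,y)\}$. For a closed set $S\subset\mathbb{R}^m$ and $x\in S$, the Fréchet normal cone $\widehat{N}_S(x)$ is the set of $\zeta\in\mathbb{R}^m$ with $\limsup_{S\ni y\to x}\frac{\langle\zeta,y-x\rangle}{\|y-x\|}\le 0$, i.e. for every $\varepsilon>0$ there is $\delta>0$ with $\langle\zeta,y-x\rangle\le\varepsilon\|y-x\|$ for all $y\in S$ with $\|y-x\|<\delta$. *)

theory Defs
  imports "HOL-Analysis.Analysis"
begin

definition abs_continuous_on :: "real \<Rightarrow> real \<Rightarrow> (real \<Rightarrow> 'a::real_normed_vector) \<Rightarrow> bool" where
  "abs_continuous_on a b f \<longleftrightarrow>
     (\<forall>\<epsilon>>0. \<exists>\<delta>>0. \<forall>(n::nat) s t.
        (\<forall>i<n. a \<le> s i \<and> s i \<le> t i \<and> t i \<le> b) \<and>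
        disjoint_family_on (\<lambda>i. {s i<..<t i}) {..<n} \<and>
        (\<Sum>i<n. t i - s i) < \<delta>
        \<longrightarrow> (\<Sum>i<n. norm (f (t i) - f (s i))) < \<epsilon>)"

definition is_trajectory ::
    "('a::euclidean_space \<Rightarrow> 'a set) \<Rightarrow> real \<Rightarrow> real \<Rightarrow> (real \<Rightarrow> 'a) \<Rightarrow> bool" where
  "is_trajectory F a b x \<longleftrightarrow>
     abs_continuous_on a b x \<and>
     (AE t in lebesgue_on {a..b}.
        \<exists>v\<in>F (x t). (x has_vector_derivative v) (at t within {a..b}))"

(* Inf {} = \<infinity> in ereal covers the case where no trajectory exists. *)
definition min_time :: "('a::euclidean_space \<Rightarrow> 'a set) \<Rightarrow> 'a \<Rightarrow> 'a \<Rightarrow> ereal" where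
  "min_time F \<alpha> \<beta> =
     Inf {ereal \<tau> | \<tau>. 0 \<le> \<tau> \<and> (\<exists>x. is_trajectory F 0 \<tau> x \<and> x 0 = \<alpha> \<and> x \<tau> = \<beta>)}"

(* Least is the minimum of a set of reals; Min would be restricted to finite sets.
   The lemma below shows that it is attained for compact nonempty values of F. *)
definition hamiltonian :: "('a::euclidean_space \<Rightarrow> 'a set) \<Rightarrow> 'a \<Rightarrow> 'a \<Rightarrow> real" where
  "hamiltonian F x p = (LEAST m. m \<in> (\<lambda>v. v \<bullet> p) ` F x)"

definition reach_set :: "('a::euclidean_space \<Rightarrow> 'a set) \<Rightarrow> real \<Rightarrow> ('a \<times> 'a) set" where
  "reach_set F t = {(x, y). min_time F x y \<le> ereal t}"

definition epi_min_time :: "('a::euclidean_space \<Rightarrow> 'a set) \<Rightarrow> (('a \<times> 'a) \<times> real) set" where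
  "epi_min_time F = {((x, y), \<mu>). min_time F x y < \<infinity> \<and> min_time F x y \<le> ereal \<mu>}"

(* Meant for closed S and x in S. *)
definition frechet_normal_cone :: "'a::real_inner set \<Rightarrow> 'a \<Rightarrow> 'a set" where
  "frechet_normal_cone S x =
     {\<zeta>. \<forall>\<epsilon>>0. \<exists>\<delta>>0. \<forall>y\<in>S. norm (y - x) < \<delta> \<longrightarrow> \<zeta> \<bullet> (y - x) \<le> \<epsilon> * norm (y - x)}"

lemma hamiltonian_attained:
  assumes "compact (F x)" "F x \<noteq> {}"
  shows "(\<exists>v\<in>F x. hamiltonian F x p = v \<bullet> p) \<and> (\<forall>w\<in>F x. hamiltonian F x p \<le> w \<bullet> p)"
proof -
  have "continuous_on (F x) (\<lambda>v. v \<bullet> p)"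
    by (intro continuous_intros)
  then obtain v where v: "v \<in> F x" "\<forall>w\<in>F x. v \<bullet> p \<le> w \<bullet> p"
    using continuous_attains_inf[OF assms] by blast
  then have "hamiltonian F x p = v \<bullet> p"
    unfolding hamiltonian_def by (intro Least_equality) auto
  with v show ?thesis by auto
qed

end

theory Submission
  imports Defs
begin

text \<open>
  Along a short trajectory starting near \<open>\<alpha>\<close>, convexity of the values and the Lipschitz property
  bound the increment of \<open>\<zeta>\<close> from below by the Hamiltonian \<open>h \<alpha> \<zeta>\<close>, up to a small error;
  conversely, for every \<open>w \<in> F \<beta>\<close> there is a trajectory from any point near \<open>\<beta>\<close> with velocity
  close to \<open>w\<close>. Given a normal to the reachable set, cut a piece of duration \<open>t\<close> off the beginning
  of a nearly optimal trajectory and append a piece of duration \<open>t\<close> with velocity near \<open>w\<close>: the new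
  pair of endpoints is again within time \<open>r\<close>, and the normal inequality yields
  \<open>h \<alpha> \<zeta> \<le> - (\<theta> \<bullet> w)\<close>. Time reversal, i.e. replacing \<open>F\<close> by \<open>- F\<close>, gives the opposite inequality.
  Cutting alone (when the time exceeds \<open>r\<close>) or appending alone (when time is left) transfers normals
  between the reachable set and the epigraph.
\<close>

section \<open>Absolutely continuous functions\<close>

text \<open>The two surgeries are asymmetric. The piece cut off belongs to an unknown trajectory, so
  only the lower bound by the Hamiltonian is known about it; the appended piece has a velocity of
  choice, and \<open>w\<close> can be taken to attain the minimum
  \<open>hamiltonian F \<beta> (- \<theta>)\<close>. This is why the direct argument gives one
  inequality and reversal has to supply the other. A Frechet inequality allows an error proportional
  to the displacement, so every surgery of duration \<open>t\<close> must come with a bound of its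
  displacement by a constant times \<open>t\<close>, the constant not depending on the tolerance;
  after division by \<open>t\<close> only first-order terms survive. Strict inequalities on
  \<open>min_time\<close>, from which nearly optimal trajectories are drawn, are bought with a slack
  \<open>t * t\<close>, negligible against \<open>t\<close>. On the epigraph, heights above
  \<open>r\<close> call for a cut and heights up to \<open>r\<close> for an extension; both must
  produce the same slope, hence the equality of the Hamiltonians comes before the transfer of
  normals.\<close>

lemma AE_lebesgue_on_iff_negligible:
  fixes S :: "'a::euclidean_space set"
  assumes "S \<in> sets lebesgue"
  shows "(AE t in lebesgue_on S. P t) \<longleftrightarrow> negligible {t \<in> S. \<not> P t}"
proof -
  have "(AE t in lebesgue_on S. P t) \<longleftrightarrow> (AE t in lebesgue. t \<in> S \<longrightarrow> P t)"
    using assms by (simp add: AE_restrict_space_iff)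
  also have "\<dots> \<longleftrightarrow> {t \<in> S. \<not> P t} \<in> null_sets lebesgue"
    by (simp add: completion.AE_iff_null_sets)
  finally show ?thesis by (simp add: negligible_iff_null_sets)
qed

lemma abs_continuous_onD:
  assumes "abs_continuous_on a b f" "0 < \<epsilon>"
  obtains \<delta> where "0 < \<delta>"
    "\<And>(n::nat) s t. (\<And>i. i < n \<Longrightarrow> a \<le> s i \<and> s i \<le> t i \<and> t i \<le> b) \<Longrightarrow>
        disjoint_family_on (\<lambda>i. {s i<..<t i}) {..<n} \<Longrightarrow>
        (\<Sum>i<n. t i - s i) < \<delta> \<Longrightarrow> (\<Sum>i<n. norm (f (t i) - f (s i))) < \<epsilon>"
proof -
  obtain \<delta> where "0 < \<delta>" and *: "\<forall>(n::nat) s t. (\<forall>i<n. a \<le> s i \<and> s i \<le> t i \<and> t i \<le> b) \<and>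
        disjoint_family_on (\<lambda>i. {s i<..<t i}) {..<n} \<and>
        (\<Sum>i<n. t i - s i) < \<delta> \<longrightarrow> (\<Sum>i<n. norm (f (t i) - f (s i))) < \<epsilon>"
    using assms(1)[unfolded abs_continuous_on_def, rule_format, OF assms(2)] by (elim exE conjE)
  show thesis
    by (rule that[OF \<open>0 < \<delta>\<close>], rule *[rule_format]) simp
qed

text \<open>A tagged division that is fine with respect to the derivative at good tags, and whose
  intervals with bad tags lie in an open set of small measure, reduces the claim to a finite sum.\<close>

lemma abs_continuous_increment_ge:
  fixes g :: "real \<Rightarrow> real"
  assumes ac: "abs_continuous_on a b g" and ab: "a \<le> b"
    and der: "AE t in lebesgue_on {a..b}. \<exists>d\<ge>m. (g has_vector_derivative d) (at t within {a..b})"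
  shows "m * (b - a) \<le> g b - g a"
proof (rule field_le_epsilon)
  fix e :: real assume e: "0 < e"
  \<comment> \<open>Error budget: \<open>\<eta>\<close> costs at most e / 2 over the interval; the
    increments and the lengths of the badly tagged intervals cost e / 4 each. The added 1 keeps the
    denominator positive when a = b.\<close>
  define \<eta> where "\<eta> = e / (2 * (b - a + 1))"
  have \<eta>: "0 < \<eta>" "\<eta> * (b - a) \<le> e / 2" using e ab by (auto simp: \<eta>_def field_simps)
  define N where "N = {t \<in> {a..b}. \<not> (\<exists>d\<ge>m. (g has_vector_derivative d) (at t within {a..b}))}"
  have N: "negligible N"
    using der unfolding N_def by (subst (asm) AE_lebesgue_on_iff_negligible) auto
  obtain \<delta> where \<delta>: "0 < \<delta>"
    "\<And>(n::nat) s t. (\<And>i. i < n \<Longrightarrow> a \<le> s i \<and> s i \<le> t i \<and> t i \<le> b) \<Longrightarrow>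
        disjoint_family_on (\<lambda>i. {s i<..<t i}) {..<n} \<Longrightarrow>
        (\<Sum>i<n. t i - s i) < \<delta> \<Longrightarrow> (\<Sum>i<n. norm (g (t i) - g (s i))) < e / 4"
    using abs_continuous_onD[OF ac, of "e / 4"] e by auto
  define \<delta>' where "\<delta>' = min \<delta> (e / (4 * (\<bar>m\<bar> + \<eta> + 1)))"
  have \<delta>': "0 < \<delta>'" using \<delta>(1) e \<eta>(1) by (auto simp: \<delta>'_def)
  obtain U where U: "open U" "N \<subseteq> U" "(U - N) \<in> lmeasurable"
    and "emeasure lebesgue (U - N) < ennreal \<delta>'"
    using sets_lebesgue_outer_open[OF negligible_imp_sets[OF N] \<delta>'] .
  then have U': "measure lebesgue (U - N) < \<delta>'"
    using \<delta>' by (simp add: emeasure_eq_measure2 ennreal_less_iff)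
  have Um: "U \<in> lmeasurable" "measure lebesgue U < \<delta>'"
  proof -
    have eq: "U = (U - N) \<union> N" using U(2) by auto
    show "U \<in> lmeasurable"
      by (subst eq, rule fmeasurable.Un[OF U(3) negligible_imp_measurable[OF N]])
    have "measure lebesgue U = measure lebesgue (U - N)"
      using measure_Diff_null_set[of U lebesgue N] N U(1) by (auto simp: negligible_iff_null_sets)
    then show "measure lebesgue U < \<delta>'" using U' by simp
  qed
  \<comment> \<open>A division interval contains its tag, so the increment over it is the sum of one
    increment on either side of the tag.\<close>
  have "\<exists>\<rho>>0. \<forall>y\<in>{a..b}. \<bar>y - t\<bar> < \<rho> \<longrightarrow>
      (t \<le> y \<longrightarrow> (m - \<eta>) * (y - t) \<le> g y - g t) \<and> (y \<le> t \<longrightarrow> (m - \<eta>) * (t - y) \<le> g t - g y)"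
    if tN: "t \<in> {a..b} - N" for t
  proof -
    from tN obtain d where d: "m \<le> d" "(g has_vector_derivative d) (at t within {a..b})"
      unfolding N_def by auto
    then have "\<forall>e>0. \<exists>\<rho>>0. \<forall>y\<in>{a..b}. norm (y - t) < \<rho> \<longrightarrow>
        norm (g y - g t - (y - t) *\<^sub>R d) \<le> e * norm (y - t)"
      unfolding has_vector_derivative_def has_derivative_within_alt by blast
    then obtain \<rho> where \<rho>: "0 < \<rho>"
      "\<And>y. y \<in> {a..b} \<Longrightarrow> \<bar>y - t\<bar> < \<rho> \<Longrightarrow> \<bar>g y - g t - (y - t) * d\<bar> \<le> \<eta> * \<bar>y - t\<bar>"
      using \<eta>(1) unfolding real_norm_def real_scaleR_def by blast
    show ?thesis
    proof (intro exI conjI ballI impI)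
      fix y assume y: "y \<in> {a..b}" "\<bar>y - t\<bar> < \<rho>" "t \<le> y"
      have "m * (y - t) \<le> d * (y - t)" using d y by (intro mult_right_mono) auto
      then show "(m - \<eta>) * (y - t) \<le> g y - g t"
        using abs_le_D2[OF \<rho>(2)[OF y(1,2)]] y(3) by (simp add: algebra_simps)
    next
      fix y assume y: "y \<in> {a..b}" "\<bar>y - t\<bar> < \<rho>" "y \<le> t"
      have "m * (t - y) \<le> d * (t - y)" using d y by (intro mult_right_mono) auto
      then show "(m - \<eta>) * (t - y) \<le> g t - g y"
        using abs_le_D1[OF \<rho>(2)[OF y(1,2)]] y(3) by (simp add: algebra_simps)
    qed (use \<rho> in auto)
  qed
  then have "\<forall>t\<in>{a..b} - N. \<exists>\<rho>>0. \<forall>y\<in>{a..b}. \<bar>y - t\<bar> < \<rho> \<longrightarrow>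
      (t \<le> y \<longrightarrow> (m - \<eta>) * (y - t) \<le> g y - g t) \<and> (y \<le> t \<longrightarrow> (m - \<eta>) * (t - y) \<le> g t - g y)"
    by blast
  from bchoice[OF this]
  obtain \<rho> where \<rho>: "\<And>t. t \<in> {a..b} - N \<Longrightarrow> 0 < \<rho> t"
     "\<And>t y. t \<in> {a..b} - N \<Longrightarrow> y\<in>{a..b} \<Longrightarrow> \<bar>y - t\<bar> < \<rho> t \<Longrightarrow> t \<le> y \<Longrightarrow> (m - \<eta>) * (y - t) \<le> g y - g t"
     "\<And>t y. t \<in> {a..b} - N \<Longrightarrow> y\<in>{a..b} \<Longrightarrow> \<bar>y - t\<bar> < \<rho> t \<Longrightarrow> y \<le> t \<Longrightarrow> (m - \<eta>) * (t - y) \<le> g t - g y"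
    by blast
  \<comment> \<open>A tag in \<open>N\<close> confines its interval to \<open>U\<close>, so the
    total length of such intervals is small; absolute continuity then controls their increments
    together.\<close>
  define G where "G t = (if t \<in> N then U else if t \<in> {a..b} then ball t (\<rho> t) else UNIV)" for t
  have "gauge G" unfolding gauge_def G_def using U \<rho>(1) by auto
  then obtain p where p: "p tagged_division_of {a..b}" "G fine p"
    using fine_division_exists_real by blast
  have fin: "finite p" using p by blast
  have mem: "\<exists>u v. u \<le> v \<and> K = {u..v} \<and> a \<le> u \<and> v \<le> b \<and> t \<in> {u..v} \<and> K \<subseteq> G t" if tK: "(t, K) \<in> p" for t K
  proof -
    obtain u v where "K = cbox u v" "t \<in> K" "K \<subseteq> {a..b}" using tagged_division_ofD(2-4)[OF p(1) tK] by metis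
    then show ?thesis using fineD[OF p(2) tK]
      by (intro exI[of _ u] exI[of _ v]) auto
  qed
  let ?D = "\<lambda>q. \<Sum>(t,K)\<in>q. g (Sup K) - g (Inf K)"
  let ?l = "\<lambda>q. \<Sum>(t,K)\<in>q. Sup K - Inf K"
  define B where "B = {(t, K) \<in> p. t \<in> N}"
  have Bp: "B \<subseteq> p" "finite B" using fin by (auto simp: B_def intro: finite_subset)
  have good: "(m - \<eta>) * ?l (p - B) \<le> ?D (p - B)"
    unfolding sum_distrib_left
  proof (rule sum_mono, clarify)
    fix t K assume "(t, K) \<in> p" "(t, K) \<notin> B"
    then have tN: "t \<notin> N" by (auto simp: B_def)
    obtain u v where uv: "u \<le> v" "K = {u..v}" "a \<le> u" "v \<le> b" "t \<in> {u..v}" "K \<subseteq> G t"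
      using mem[OF \<open>(t, K) \<in> p\<close>] by blast
    then have t: "t \<in> {a..b} - N" using tN by auto
    have "u \<in> ball t (\<rho> t)" "v \<in> ball t (\<rho> t)" using uv t by (auto simp: G_def simp del: mem_ball)
    then have "(m - \<eta>) * (v - t) \<le> g v - g t" "(m - \<eta>) * (t - u) \<le> g t - g u"
      using \<rho>(2)[OF t, of v] \<rho>(3)[OF t, of u] uv by (auto simp: dist_real_def)
    then show "(m - \<eta>) * (Sup K - Inf K) \<le> g (Sup K) - g (Inf K)"
      using uv by (simp add: algebra_simps)
  qed
  \<comment> \<open>Absolute continuity speaks of families indexed by initial segments of the
    naturals, so the badly tagged pairs are enumerated.\<close>
  obtain h where h: "bij_betw h {..<card B} B"
    using ex_bij_betw_nat_finite[OF Bp(2)] by (auto simp: atLeast0LessThan)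
  define s where "s i = Inf (snd (h i))" for i
  define t where "t i = Sup (snd (h i))" for i
  have hB: "h i \<in> B" if "i < card B" for i using h that by (auto simp: bij_betw_def)
  have st: "a \<le> s i \<and> s i \<le> t i \<and> t i \<le> b \<and> {s i<..<t i} = interior (snd (h i)) \<and> {s i<..<t i} \<subseteq> U"
    if i: "i < card B" for i
  proof -
    obtain x K where hi: "h i = (x, K)" by force
    then have xK: "(x, K) \<in> p" "x \<in> N" using hB[OF i] by (auto simp: B_def)
    obtain u v where uv: "u \<le> v" "K = {u..v}" "a \<le> u" "v \<le> b" "x \<in> {u..v}" "K \<subseteq> G x"
      using mem[OF xK(1)] by blast
    then have "s i = u" "t i = v" by (auto simp: s_def t_def hi)
    then show ?thesis using uv xK by (auto simp: hi G_def)
  qed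
  have le: "a \<le> s i" "s i \<le> t i" "t i \<le> b" "{s i<..<t i} \<subseteq> U" if "i < card B" for i
    using st[OF that] by auto
  have disj: "disjoint_family_on (\<lambda>i. {s i<..<t i}) {..<card B}"
    unfolding disjoint_family_on_def
  proof (intro ballI impI)
    fix i j assume ij: "i \<in> {..<card B}" "j \<in> {..<card B}" "i \<noteq> j"
    then have ne: "h i \<noteq> h j" using h by (auto simp: bij_betw_def inj_on_def)
    obtain x K y J where eq: "h i = (x, K)" "h j = (y, J)" by force
    then have "(x, K) \<in> p" "(y, J) \<in> p" "(x, K) \<noteq> (y, J)" using hB ij ne Bp by fastforce+
    then have "interior K \<inter> interior J = {}" using tagged_division_ofD(5)[OF p(1)] by blast
    then show "{s i<..<t i} \<inter> {s j<..<t j} = {}"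
      using st[of i] st[of j] ij eq by auto
  qed
  have len: "(\<Sum>i<card B. t i - s i) < \<delta>'"
  proof -
    have "(\<Sum>i<card B. t i - s i) = (\<Sum>i<card B. measure lebesgue {s i<..<t i})"
    proof (rule sum.cong)
      fix i assume "i \<in> {..<card B}"
      then have "s i \<le> t i" using le by auto
      then show "t i - s i = measure lebesgue {s i<..<t i}" by simp
    qed simp
    also have "\<dots> = measure lebesgue (\<Union>i<card B. {s i<..<t i})"
      by (rule measure_finite_Union[symmetric]) (use disj le in \<open>auto simp: emeasure_lborel_Ioo\<close>)
    also have "\<dots> \<le> measure lebesgue U"
      by (rule measure_mono_fmeasurable) (use le(4) Um in auto)
    finally show ?thesis using Um by simp
  qed
  have sumB: "(\<Sum>z\<in>B. f z) = (\<Sum>i<card B. f (h i))" for f :: "real \<times> real set \<Rightarrow> real"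
    using sum.reindex_bij_betw[OF h, of f] by simp
  have lB: "?l B = (\<Sum>i<card B. t i - s i)" "?D B = (\<Sum>i<card B. g (t i) - g (s i))"
    by (simp_all add: sumB split_def s_def t_def)
  have "(\<Sum>i<card B. norm (g (t i) - g (s i))) < e / 4"
    by (rule \<delta>(2)) (use le(1-3) disj len in \<open>auto simp: \<delta>'_def\<close>)
  moreover have "norm (\<Sum>i<card B. g (t i) - g (s i)) \<le> (\<Sum>i<card B. norm (g (t i) - g (s i)))"
    by (rule norm_sum)
  ultimately have DB: "- (e / 4) \<le> ?D B"
    unfolding lB real_norm_def by linarith
  have "(m - \<eta>) * ?l B \<le> (\<bar>m\<bar> + \<eta> + 1) * (e / (4 * (\<bar>m\<bar> + \<eta> + 1)))"
  proof (rule mult_mono)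
    show "?l B \<le> e / (4 * (\<bar>m\<bar> + \<eta> + 1))" using len by (simp add: lB \<delta>'_def)
    show "0 \<le> ?l B" unfolding lB using le(2) by (auto intro: sum_nonneg)
  qed (use \<eta> in auto)
  also have "\<dots> = e / 4" using \<eta> by (simp add: field_simps)
  finally have lB': "(m - \<eta>) * ?l B \<le> e / 4" .
  have split: "?l p = ?l B + ?l (p - B)" "?D p = ?D B + ?D (p - B)"
    using sum.subset_diff[OF Bp(1) fin] by (auto simp: add.commute)
  have tot: "?l p = b - a" "?D p = g b - g a"
    using additive_tagged_division_1[OF ab p(1)] by auto
  have "(m - \<eta>) * (b - a) = (m - \<eta>) * ?l B + (m - \<eta>) * ?l (p - B)"
    by (simp only: tot(1)[symmetric] split(1) distrib_left)
  also have "\<dots> \<le> e / 4 + ?D (p - B)" using good lB' by linarith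
  also have "\<dots> \<le> e / 2 + (g b - g a)" using DB split(2) tot(2) by linarith
  finally have "m * (b - a) - \<eta> * (b - a) \<le> e / 2 + (g b - g a)" by (simp only: left_diff_distrib)
  then show "m * (b - a) \<le> g b - g a + e" using \<eta>(2) by linarith
qed

text \<open>Absolute continuity only sees increments. This one principle covers equal values, inner
  products and, with \<open>f\<close> the identity, curves that are Lipschitz in time.\<close>

lemma abs_continuous_on_bound:
  assumes ac: "abs_continuous_on a b f"
    and le: "\<And>s t. s \<in> {a..b} \<Longrightarrow> t \<in> {a..b} \<Longrightarrow> norm (g t - g s) \<le> C * norm (f t - f s)"
  shows "abs_continuous_on a b g"
  unfolding abs_continuous_on_def
proof (intro allI impI)
  fix \<epsilon> :: real assume \<epsilon>: "0 < \<epsilon>"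
  define D where "D = \<bar>C\<bar> + 1"
  have D: "0 < D" "C \<le> D" unfolding D_def by linarith+
  have le': "norm (g t - g s) \<le> D * norm (f t - f s)" if "s \<in> {a..b}" "t \<in> {a..b}" for s t
    by (rule order_trans[OF le[OF that] mult_right_mono[OF D(2) norm_ge_zero]])
  obtain \<delta> where \<delta>: "0 < \<delta>"
    "\<And>(n::nat) s t. (\<And>i. i < n \<Longrightarrow> a \<le> s i \<and> s i \<le> t i \<and> t i \<le> b) \<Longrightarrow>
        disjoint_family_on (\<lambda>i. {s i<..<t i}) {..<n} \<Longrightarrow>
        (\<Sum>i<n. t i - s i) < \<delta> \<Longrightarrow> (\<Sum>i<n. norm (f (t i) - f (s i))) < \<epsilon> / D"
    using abs_continuous_onD[OF ac divide_pos_pos[OF \<epsilon> D(1)]] by blast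
  show "\<exists>\<delta>>0. \<forall>(n::nat) s t. (\<forall>i<n. a \<le> s i \<and> s i \<le> t i \<and> t i \<le> b) \<and>
        disjoint_family_on (\<lambda>i. {s i<..<t i}) {..<n} \<and> (\<Sum>i<n. t i - s i) < \<delta>
        \<longrightarrow> (\<Sum>i<n. norm (g (t i) - g (s i))) < \<epsilon>"
  proof (intro exI[of _ \<delta>] conjI allI impI \<delta>(1), elim conjE)
    fix n :: nat and s t
    assume st: "\<forall>i<n. a \<le> s i \<and> s i \<le> t i \<and> t i \<le> b"
      "disjoint_family_on (\<lambda>i. {s i<..<t i}) {..<n}" "(\<Sum>i<n. t i - s i) < \<delta>"
    have "(\<Sum>i<n. norm (g (t i) - g (s i))) \<le> (\<Sum>i<n. D * norm (f (t i) - f (s i)))"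
      by (intro sum_mono le') (use st in force)+
    also have "\<dots> = D * (\<Sum>i<n. norm (f (t i) - f (s i)))" by (simp add: sum_distrib_left)
    also have "\<dots> < \<epsilon>" using \<delta>(2)[of n s t] st D by (simp add: field_simps)
    finally show "(\<Sum>i<n. norm (g (t i) - g (s i))) < \<epsilon>" .
  qed
qed

lemma abs_continuous_on_cong:
  assumes "abs_continuous_on a b f" "\<And>t. t \<in> {a..b} \<Longrightarrow> g t = f t"
  shows "abs_continuous_on a b g"
  using abs_continuous_on_bound[OF assms(1), of g 1] assms(2) by simp

lemma abs_continuous_on_inner:
  fixes f :: "real \<Rightarrow> 'a::real_inner"
  assumes "abs_continuous_on a b f"
  shows "abs_continuous_on a b (\<lambda>t. u \<bullet> f t)"
  by (rule abs_continuous_on_bound[OF assms, of _ "norm u"])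
    (simp add: inner_diff_right[symmetric] Cauchy_Schwarz_ineq2)

lemma abs_continuous_on_id: "abs_continuous_on a b (\<lambda>t::real. t)"
  unfolding abs_continuous_on_def
proof (intro allI impI)
  fix \<epsilon> :: real assume "0 < \<epsilon>"
  then show "\<exists>\<delta>>0. \<forall>(n::nat) s t. (\<forall>i<n. a \<le> s i \<and> s i \<le> t i \<and> t i \<le> b) \<and>
        disjoint_family_on (\<lambda>i. {s i<..<t i}) {..<n} \<and> (\<Sum>i<n. t i - s i) < \<delta>
        \<longrightarrow> (\<Sum>i<n. norm (t i - s i)) < \<epsilon>"
    by (intro exI[of _ \<epsilon>]) auto
qed

lemma abs_continuous_on_shift:
  assumes ac: "abs_continuous_on a b f" and "a \<le> a' + c" "b' + c \<le> b"
  shows "abs_continuous_on a' b' (\<lambda>t. f (t + c))"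
  unfolding abs_continuous_on_def
proof (intro allI impI)
  fix \<epsilon> :: real assume \<epsilon>: "0 < \<epsilon>"
  obtain \<delta> where \<delta>: "0 < \<delta>"
    "\<And>(n::nat) s t. (\<And>i. i < n \<Longrightarrow> a \<le> s i \<and> s i \<le> t i \<and> t i \<le> b) \<Longrightarrow>
        disjoint_family_on (\<lambda>i. {s i<..<t i}) {..<n} \<Longrightarrow>
        (\<Sum>i<n. t i - s i) < \<delta> \<Longrightarrow> (\<Sum>i<n. norm (f (t i) - f (s i))) < \<epsilon>"
    using abs_continuous_onD[OF ac \<epsilon>] by blast
  show "\<exists>\<delta>>0. \<forall>(n::nat) s t. (\<forall>i<n. a' \<le> s i \<and> s i \<le> t i \<and> t i \<le> b') \<and>
        disjoint_family_on (\<lambda>i. {s i<..<t i}) {..<n} \<and> (\<Sum>i<n. t i - s i) < \<delta>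
        \<longrightarrow> (\<Sum>i<n. norm (f (t i + c) - f (s i + c))) < \<epsilon>"
  proof (intro exI[of _ \<delta>] conjI allI impI \<delta>(1), elim conjE)
    fix n :: nat and s t
    assume st: "\<forall>i<n. a' \<le> s i \<and> s i \<le> t i \<and> t i \<le> b'"
      "disjoint_family_on (\<lambda>i. {s i<..<t i}) {..<n}" "(\<Sum>i<n. t i - s i) < \<delta>"
    show "(\<Sum>i<n. norm (f (t i + c) - f (s i + c))) < \<epsilon>"
    proof (rule \<delta>(2))
      show "a \<le> s i + c \<and> s i + c \<le> t i + c \<and> t i + c \<le> b" if "i < n" for i
        using st(1) that assms(2,3) by force
      have "x - c \<in> {s i<..<t i}" if "x \<in> {s i + c<..<t i + c}" for i x using that by auto
      then show "disjoint_family_on (\<lambda>i. {s i + c<..<t i + c}) {..<n}"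
        using st(2) unfolding disjoint_family_on_def by blast
    qed (use st in simp)
  qed
qed

lemma abs_continuous_on_reflect:
  assumes ac: "abs_continuous_on a b f"
  shows "abs_continuous_on (c - b) (c - a) (\<lambda>t. f (c - t))"
  unfolding abs_continuous_on_def
proof (intro allI impI)
  fix \<epsilon> :: real assume \<epsilon>: "0 < \<epsilon>"
  obtain \<delta> where \<delta>: "0 < \<delta>"
    "\<And>(n::nat) s t. (\<And>i. i < n \<Longrightarrow> a \<le> s i \<and> s i \<le> t i \<and> t i \<le> b) \<Longrightarrow>
        disjoint_family_on (\<lambda>i. {s i<..<t i}) {..<n} \<Longrightarrow>
        (\<Sum>i<n. t i - s i) < \<delta> \<Longrightarrow> (\<Sum>i<n. norm (f (t i) - f (s i))) < \<epsilon>"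
    using abs_continuous_onD[OF ac \<epsilon>] by blast
  show "\<exists>\<delta>>0. \<forall>(n::nat) s t. (\<forall>i<n. c - b \<le> s i \<and> s i \<le> t i \<and> t i \<le> c - a) \<and>
        disjoint_family_on (\<lambda>i. {s i<..<t i}) {..<n} \<and> (\<Sum>i<n. t i - s i) < \<delta>
        \<longrightarrow> (\<Sum>i<n. norm (f (c - t i) - f (c - s i))) < \<epsilon>"
  proof (intro exI[of _ \<delta>] conjI allI impI \<delta>(1), elim conjE)
    fix n :: nat and s t
    assume st: "\<forall>i<n. c - b \<le> s i \<and> s i \<le> t i \<and> t i \<le> c - a"
      "disjoint_family_on (\<lambda>i. {s i<..<t i}) {..<n}" "(\<Sum>i<n. t i - s i) < \<delta>"
    have "(\<Sum>i<n. norm (f (c - s i) - f (c - t i))) < \<epsilon>"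
    proof (rule \<delta>(2))
      show "a \<le> c - t i \<and> c - t i \<le> c - s i \<and> c - s i \<le> b" if "i < n" for i
        using st(1) that by force
      have "c - x \<in> {s i<..<t i}" if "x \<in> {c - t i<..<c - s i}" for i x using that by auto
      then show "disjoint_family_on (\<lambda>i. {c - t i<..<c - s i}) {..<n}"
        using st(2) unfolding disjoint_family_on_def by blast
    qed (use st in simp)
    then show "(\<Sum>i<n. norm (f (c - t i) - f (c - s i))) < \<epsilon>"
      by (simp add: norm_minus_commute)
  qed
qed

text \<open>Each interval is split at \<open>b\<close> by \<open>min\<close> and \<open>max\<close>;
  a part on the wrong side degenerates to the point \<open>b\<close>. Clipping never lengthens an
  interval and keeps the family disjoint, so each half gets its own share \<epsilon> / 2.\<close>

lemma abs_continuous_on_join: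
  assumes ac1: "abs_continuous_on a b f" and ac2: "abs_continuous_on b c f" and abc: "a \<le> b" "b \<le> c"
  shows "abs_continuous_on a c f"
  unfolding abs_continuous_on_def
proof (intro allI impI)
  fix \<epsilon> :: real assume "0 < \<epsilon>"
  then have \<epsilon>: "0 < \<epsilon> / 2" by simp
  obtain \<delta> where \<delta>: "0 < \<delta>"
    "\<And>(n::nat) s t. (\<And>i. i < n \<Longrightarrow> a \<le> s i \<and> s i \<le> t i \<and> t i \<le> b) \<Longrightarrow>
        disjoint_family_on (\<lambda>i. {s i<..<t i}) {..<n} \<Longrightarrow>
        (\<Sum>i<n. t i - s i) < \<delta> \<Longrightarrow> (\<Sum>i<n. norm (f (t i) - f (s i))) < \<epsilon> / 2"
    using abs_continuous_onD[OF ac1 \<epsilon>] by blast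
  obtain \<delta>' where \<delta>': "0 < \<delta>'"
    "\<And>(n::nat) s t. (\<And>i. i < n \<Longrightarrow> b \<le> s i \<and> s i \<le> t i \<and> t i \<le> c) \<Longrightarrow>
        disjoint_family_on (\<lambda>i. {s i<..<t i}) {..<n} \<Longrightarrow>
        (\<Sum>i<n. t i - s i) < \<delta>' \<Longrightarrow> (\<Sum>i<n. norm (f (t i) - f (s i))) < \<epsilon> / 2"
    using abs_continuous_onD[OF ac2 \<epsilon>] by blast
  show "\<exists>\<delta>>0. \<forall>(n::nat) s t. (\<forall>i<n. a \<le> s i \<and> s i \<le> t i \<and> t i \<le> c) \<and>
        disjoint_family_on (\<lambda>i. {s i<..<t i}) {..<n} \<and> (\<Sum>i<n. t i - s i) < \<delta>
        \<longrightarrow> (\<Sum>i<n. norm (f (t i) - f (s i))) < \<epsilon>"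
  proof (intro exI[of _ "min \<delta> \<delta>'"] conjI allI impI, goal_cases)
    case 1 show ?case using \<delta>(1) \<delta>'(1) by simp
  next
    case (2 n s t)
    then have st: "\<And>i. i < n \<Longrightarrow> a \<le> s i \<and> s i \<le> t i \<and> t i \<le> c"
      "disjoint_family_on (\<lambda>i. {s i<..<t i}) {..<n}" "(\<Sum>i<n. t i - s i) < min \<delta> \<delta>'" by auto
    have sm: "(\<Sum>i<n. norm (f (min (t i) b) - f (min (s i) b))) < \<epsilon> / 2"
    proof (rule \<delta>(2))
      show "a \<le> min (s i) b \<and> min (s i) b \<le> min (t i) b \<and> min (t i) b \<le> b" if "i < n" for i
        using st(1)[OF that] abc by auto
      have "{min (s i) b<..<min (t i) b} \<subseteq> {s i<..<t i}" for i by auto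
      then show "disjoint_family_on (\<lambda>i. {min (s i) b<..<min (t i) b}) {..<n}"
        using st(2) unfolding disjoint_family_on_def by blast
      have "(\<Sum>i<n. min (t i) b - min (s i) b) \<le> (\<Sum>i<n. t i - s i)"
        using st(1) by (intro sum_mono) (force simp: min_def)
      then show "(\<Sum>i<n. min (t i) b - min (s i) b) < \<delta>" using st(3) by simp
    qed
    have sM: "(\<Sum>i<n. norm (f (max (t i) b) - f (max (s i) b))) < \<epsilon> / 2"
    proof (rule \<delta>'(2))
      show "b \<le> max (s i) b \<and> max (s i) b \<le> max (t i) b \<and> max (t i) b \<le> c" if "i < n" for i
        using st(1)[OF that] abc by auto
      have "{max (s i) b<..<max (t i) b} \<subseteq> {s i<..<t i}" for i by auto
      then show "disjoint_family_on (\<lambda>i. {max (s i) b<..<max (t i) b}) {..<n}"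
        using st(2) unfolding disjoint_family_on_def by blast
      have "(\<Sum>i<n. max (t i) b - max (s i) b) \<le> (\<Sum>i<n. t i - s i)"
        using st(1) by (intro sum_mono) (force simp: max_def)
      then show "(\<Sum>i<n. max (t i) b - max (s i) b) < \<delta>'" using st(3) by simp
    qed
    have "norm (f t - f s) \<le> norm (f (min t b) - f (min s b)) + norm (f (max t b) - f (max s b))" for s t
    proof -
      have "f (min t b) + f (max t b) = f t + f b" for t by (cases "t \<le> b") (auto simp: min_def max_def)
      then have "f t - f s = (f (min t b) - f (min s b)) + (f (max t b) - f (max s b))"
        by (smt (verit) add_diff_add add_diff_cancel_right)
      then show ?thesis using norm_triangle_ineq by metis
    qed
    then have "(\<Sum>i<n. norm (f (t i) - f (s i))) \<le>
       (\<Sum>i<n. norm (f (min (t i) b) - f (min (s i) b))) + (\<Sum>i<n. norm (f (max (t i) b) - f (max (s i) b)))"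
      unfolding sum.distrib[symmetric] by (intro sum_mono)
    then show "(\<Sum>i<n. norm (f (t i) - f (s i))) < \<epsilon>" using sm sM by linarith
  qed
qed

lemma abs_continuous_on_imp_continuous_on:
  assumes "abs_continuous_on a b f"
  shows "continuous_on {a..b} f"
  unfolding continuous_on_iff
proof (intro ballI allI impI)
  fix x \<epsilon> :: real assume x: "x \<in> {a..b}" and \<epsilon>: "0 < \<epsilon>"
  obtain \<delta> where \<delta>: "0 < \<delta>"
    "\<And>(n::nat) s t. (\<And>i. i < n \<Longrightarrow> a \<le> s i \<and> s i \<le> t i \<and> t i \<le> b) \<Longrightarrow>
        disjoint_family_on (\<lambda>i. {s i<..<t i}) {..<n} \<Longrightarrow>
        (\<Sum>i<n. t i - s i) < \<delta> \<Longrightarrow> (\<Sum>i<n. norm (f (t i) - f (s i))) < \<epsilon>"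
    using abs_continuous_onD[OF assms \<epsilon>] by blast
  have *: "norm (f t - f s) < \<epsilon>" if "a \<le> s" "s \<le> t" "t \<le> b" "t - s < \<delta>" for s t
    using \<delta>(2)[of 1 "\<lambda>_. s" "\<lambda>_. t"] that by (simp add: disjoint_family_on_def lessThan_Suc)
  have "dist (f y) (f x) < \<epsilon>" if "y \<in> {a..b}" "dist y x < \<delta>" for y
    using *[of x y] *[of y x] x that
    by (cases "x \<le> y") (auto simp: dist_norm norm_minus_commute)
  then show "\<exists>d>0. \<forall>x'\<in>{a..b}. dist x' x < d \<longrightarrow> dist (f x') (f x) < \<epsilon>" using \<delta>(1) by blast
qed

section \<open>Trajectories and the minimal time function\<close>

text \<open>The endpoints form a null set, so the derivative is only asked for at interior times, in
  the two-sided form that the chain rule and local modifications of a curve work with.\<close>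

lemma is_trajectoryI:
  assumes ac: "abs_continuous_on a b x" and N: "negligible N"
    and der: "\<And>t. a < t \<Longrightarrow> t < b \<Longrightarrow> t \<notin> N \<Longrightarrow> \<exists>v\<in>F (x t). (x has_vector_derivative v) (at t)"
  shows "is_trajectory F a b x"
proof -
  have "negligible {t \<in> {a..b}. \<not> (\<exists>v\<in>F (x t). (x has_vector_derivative v) (at t within {a..b}))}"
  proof (rule negligible_subset)
    show "negligible (N \<union> {a, b})" using N by simp
    show "{t \<in> {a..b}. \<not> (\<exists>v\<in>F (x t). (x has_vector_derivative v) (at t within {a..b}))} \<subseteq> N \<union> {a, b}"
      using der has_vector_derivative_at_within by (fastforce simp: order_le_less)
  qed
  then show ?thesis unfolding is_trajectory_def using ac
    by (simp add: AE_lebesgue_on_iff_negligible)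
qed

lemma is_trajectoryE:
  assumes "is_trajectory F a b x"
  obtains N where "abs_continuous_on a b x" "negligible N"
    "\<And>t. a < t \<Longrightarrow> t < b \<Longrightarrow> t \<notin> N \<Longrightarrow> \<exists>v\<in>F (x t). (x has_vector_derivative v) (at t)"
proof
  let ?N = "{t \<in> {a..b}. \<not> (\<exists>v\<in>F (x t). (x has_vector_derivative v) (at t within {a..b}))}"
  show "abs_continuous_on a b x" "negligible ?N"
    using assms by (simp_all add: is_trajectory_def AE_lebesgue_on_iff_negligible)
  fix t assume t: "a < t" "t < b" "t \<notin> ?N"
  have "at t within {a..b} = at t" using t by (intro at_within_interior) auto
  then show "\<exists>v\<in>F (x t). (x has_vector_derivative v) (at t)" using t by auto
qed

text \<open>Restriction to a subinterval is the case c = 0; cutting a trajectory uses the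
  restriction for the initial piece and the shift for the rest.\<close>

lemma is_trajectory_shift:
  assumes tr: "is_trajectory F a b x" and le: "a \<le> a' + c" "b' + c \<le> b"
  shows "is_trajectory F a' b' (\<lambda>t. x (t + c))"
proof -
  obtain N where N: "abs_continuous_on a b x" "negligible N"
    "\<And>t. a < t \<Longrightarrow> t < b \<Longrightarrow> t \<notin> N \<Longrightarrow> \<exists>v\<in>F (x t). (x has_vector_derivative v) (at t)"
    using is_trajectoryE[OF tr] by blast
  show ?thesis
  proof (rule is_trajectoryI)
    show "negligible ((+) (- c) ` N)" using N(2) negligible_translation by blast
    fix t assume t: "a' < t" "t < b'" "t \<notin> (+) (- c) ` N"
    then have "t + c \<notin> N" by force
    then obtain v where "v \<in> F (x (t + c))" "(x has_vector_derivative v) (at (t + c))"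
      using N(3)[of "t + c"] t le by auto
    moreover have "((\<lambda>t. t + c) has_vector_derivative 1) (at t)"
      by (auto intro!: derivative_eq_intros)
    ultimately show "\<exists>v\<in>F (x (t + c)). ((\<lambda>t. x (t + c)) has_vector_derivative v) (at t)"
      using vector_diff_chain_at[of "\<lambda>t. t + c" 1 t x v] by (auto simp: o_def)
  qed (rule abs_continuous_on_shift[OF N(1) le])
qed

lemma is_trajectory_reflect:
  assumes tr: "is_trajectory F 0 \<tau> x"
  shows "is_trajectory (\<lambda>y. uminus ` F y) 0 \<tau> (\<lambda>t. x (\<tau> - t))"
proof -
  obtain N where N: "abs_continuous_on 0 \<tau> x" "negligible N"
    "\<And>t. 0 < t \<Longrightarrow> t < \<tau> \<Longrightarrow> t \<notin> N \<Longrightarrow> \<exists>v\<in>F (x t). (x has_vector_derivative v) (at t)"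
    using is_trajectoryE[OF tr] by blast
  show ?thesis
  proof (rule is_trajectoryI)
    show "negligible ((\<lambda>t. \<tau> - t) ` N)"
      by (rule negligible_differentiable_image_negligible[OF _ N(2)]) (auto intro!: derivative_intros)
    fix t assume t: "0 < t" "t < \<tau>" "t \<notin> (\<lambda>t. \<tau> - t) ` N"
    then have "\<tau> - t \<notin> N" by force
    then obtain v where "v \<in> F (x (\<tau> - t))" "(x has_vector_derivative v) (at (\<tau> - t))"
      using N(3)[of "\<tau> - t"] t by auto
    moreover have "((\<lambda>t. \<tau> - t) has_vector_derivative - 1) (at t)"
      by (auto intro!: derivative_eq_intros)
    ultimately show "\<exists>v\<in>uminus ` F (x (\<tau> - t)). ((\<lambda>t. x (\<tau> - t)) has_vector_derivative v) (at t)"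
      using vector_diff_chain_at[of "\<lambda>t. \<tau> - t" "-1" t x v] by (auto simp: o_def)
  qed (use abs_continuous_on_reflect[OF N(1), of \<tau>] in simp)
qed

lemma is_trajectory_join:
  assumes x: "is_trajectory F 0 a x" and y: "is_trajectory F 0 b y" and xy: "x a = y 0"
    and ab: "0 \<le> a" "0 \<le> b"
  shows "is_trajectory F 0 (a + b) (\<lambda>t. if t \<le> a then x t else y (t - a))" (is "is_trajectory F 0 _ ?z")
proof -
  have y': "is_trajectory F a (a + b) (\<lambda>t. y (t + - a))" by (rule is_trajectory_shift[OF y]) auto
  obtain N where N: "abs_continuous_on 0 a x" "negligible N"
    "\<And>t. 0 < t \<Longrightarrow> t < a \<Longrightarrow> t \<notin> N \<Longrightarrow> \<exists>v\<in>F (x t). (x has_vector_derivative v) (at t)"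
    using is_trajectoryE[OF x] by blast
  obtain M where M: "abs_continuous_on a (a + b) (\<lambda>t. y (t + - a))" "negligible M"
    "\<And>t. a < t \<Longrightarrow> t < a + b \<Longrightarrow> t \<notin> M \<Longrightarrow>
      \<exists>v\<in>F (y (t + - a)). ((\<lambda>t. y (t + - a)) has_vector_derivative v) (at t)"
    using is_trajectoryE[OF y'] by blast
  show ?thesis
  proof (rule is_trajectoryI)
    show "abs_continuous_on 0 (a + b) ?z"
    proof (rule abs_continuous_on_join)
      show "abs_continuous_on 0 a ?z" by (rule abs_continuous_on_cong[OF N(1)]) auto
      show "abs_continuous_on a (a + b) ?z" by (rule abs_continuous_on_cong[OF M(1)]) (auto simp: xy)
    qed (use ab in auto)
    \<comment> \<open>The velocities on the two sides of the junction may differ, so the time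
      \<open>a\<close> is exceptional.\<close>
    show "negligible (insert a (N \<union> M))" using N(2) M(2) by simp
    fix t assume t: "0 < t" "t < a + b" "t \<notin> insert a (N \<union> M)"
    consider "t < a" | "a < t" using t by force
    then show "\<exists>v\<in>F (?z t). (?z has_vector_derivative v) (at t)"
    proof cases
      case 1
      then obtain v where "v \<in> F (x t)" "(x has_vector_derivative v) (at t)" using N(3) t by blast
      moreover from this(2) have "(?z has_vector_derivative v) (at t)"
        by (rule has_vector_derivative_transform_within_open[of _ _ _ "{..<a}"]) (use 1 in auto)
      ultimately show ?thesis using 1 by auto
    next
      case 2
      then obtain v where "v \<in> F (y (t + - a))" "((\<lambda>t. y (t + - a)) has_vector_derivative v) (at t)"
        using M(3) t by blast
      moreover from this(2) have "(?z has_vector_derivative v) (at t)"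
        by (rule has_vector_derivative_transform_within_open[of _ _ _ "{a<..}"]) (use 2 in auto)
      ultimately show ?thesis using 2 by auto
    qed
  qed
qed

section \<open>Concatenation and reversal for the minimal time\<close>

lemma min_time_le:
  assumes "is_trajectory F 0 \<tau> x" "0 \<le> \<tau>" "x 0 = \<alpha>" "x \<tau> = \<beta>"
  shows "min_time F \<alpha> \<beta> \<le> ereal \<tau>"
  unfolding min_time_def using assms by (intro Inf_lower) blast

lemma min_time_lessE:
  assumes "min_time F \<alpha> \<beta> < ereal s"
  obtains \<tau> x where "0 \<le> \<tau>" "\<tau> < s" "is_trajectory F 0 \<tau> x" "x 0 = \<alpha>" "x \<tau> = \<beta>"
  using assms unfolding min_time_def Inf_less_iff by auto

lemma min_time_triangle:
  assumes "min_time F \<alpha> \<beta> \<le> ereal s" "min_time F \<beta> \<gamma> \<le> ereal t"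
  shows "min_time F \<alpha> \<gamma> \<le> ereal (s + t)"
proof (rule ereal_le_epsilon2)
  fix e :: real assume e: "0 < e"
  have "min_time F \<alpha> \<beta> < ereal (s + e / 2)" using assms(1) e by (auto intro: le_less_trans)
  then obtain \<sigma> x where x: "0 \<le> \<sigma>" "\<sigma> < s + e / 2" "is_trajectory F 0 \<sigma> x" "x 0 = \<alpha>" "x \<sigma> = \<beta>"
    by (rule min_time_lessE)
  have "min_time F \<beta> \<gamma> < ereal (t + e / 2)" using assms(2) e by (auto intro: le_less_trans)
  then obtain \<tau> y where y: "0 \<le> \<tau>" "\<tau> < t + e / 2" "is_trajectory F 0 \<tau> y" "y 0 = \<beta>" "y \<tau> = \<gamma>"
    by (rule min_time_lessE)
  have "min_time F \<alpha> \<gamma> \<le> ereal (\<sigma> + \<tau>)"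
    by (rule min_time_le[OF is_trajectory_join[OF x(3) y(3)]]) (use x y in auto)
  also have "\<dots> \<le> ereal (s + t) + ereal e" using x y by simp
  finally show "min_time F \<alpha> \<gamma> \<le> ereal (s + t) + ereal e" .
qed

text \<open>One implication, proved for arbitrary \<open>F\<close>, is applied to \<open>F\<close>
  and to its negative; negating twice returns \<open>F\<close>, so both directions follow.\<close>

lemma min_time_reverse: "min_time (\<lambda>y. uminus ` F y) \<beta> \<alpha> = min_time F \<alpha> \<beta>"
proof -
  have *: "\<exists>x. is_trajectory (\<lambda>y. uminus ` F y) 0 \<tau> x \<and> x 0 = \<beta> \<and> x \<tau> = \<alpha>"
    if "is_trajectory F 0 \<tau> x" "x 0 = \<alpha>" "x \<tau> = \<beta>" for F :: "'a \<Rightarrow> 'a set" and \<tau> x \<alpha> \<beta>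
    using is_trajectory_reflect[OF that(1)] that(2,3) by (intro exI[of _ "\<lambda>t. x (\<tau> - t)"]) auto
  have inv: "(\<lambda>y. uminus ` uminus ` F y) = F" by (simp add: image_image)
  have "(\<exists>x. is_trajectory (\<lambda>y. uminus ` F y) 0 \<tau> x \<and> x 0 = \<beta> \<and> x \<tau> = \<alpha>) \<longleftrightarrow>
      (\<exists>x. is_trajectory F 0 \<tau> x \<and> x 0 = \<alpha> \<and> x \<tau> = \<beta>)" for \<tau>
    using *[of F \<tau> _ \<alpha> \<beta>] *[of "\<lambda>y. uminus ` F y" \<tau> _ \<beta> \<alpha>] unfolding inv by blast
  then show ?thesis unfolding min_time_def by simp
qed

section \<open>A priori estimates along trajectories\<close>

lemma trajectory_inner_ge:
  assumes tr: "is_trajectory F 0 \<sigma> x" and \<sigma>: "0 \<le> \<sigma>"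
    and le: "\<And>t v. 0 < t \<Longrightarrow> t < \<sigma> \<Longrightarrow> v \<in> F (x t) \<Longrightarrow> m \<le> u \<bullet> v"
  shows "m * \<sigma> \<le> u \<bullet> (x \<sigma> - x 0)"
proof -
  obtain N where N: "abs_continuous_on 0 \<sigma> x" "negligible N"
    "\<And>t. 0 < t \<Longrightarrow> t < \<sigma> \<Longrightarrow> t \<notin> N \<Longrightarrow> \<exists>v\<in>F (x t). (x has_vector_derivative v) (at t)"
    using is_trajectoryE[OF tr] by blast
  have "m * (\<sigma> - 0) \<le> u \<bullet> x \<sigma> - u \<bullet> x 0"
  proof (rule abs_continuous_increment_ge[OF abs_continuous_on_inner[OF N(1)] \<sigma>])
    have *: "\<exists>d\<ge>m. ((\<lambda>t. u \<bullet> x t) has_vector_derivative d) (at t within {0..\<sigma>})"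
      if t: "0 < t" "t < \<sigma>" "t \<notin> N" for t
    proof -
      obtain v where v: "v \<in> F (x t)" "(x has_vector_derivative v) (at t)" using N(3)[OF t] by blast
      have "((\<lambda>t. u \<bullet> x t) has_vector_derivative u \<bullet> v) (at t)"
        by (rule bounded_linear.has_vector_derivative[OF bounded_linear_inner_right v(2)])
      then show ?thesis using le[OF t(1,2) v(1)] has_vector_derivative_at_within by blast
    qed
    have "negligible {t \<in> {0..\<sigma>}. \<not> (\<exists>d\<ge>m. ((\<lambda>t. u \<bullet> x t) has_vector_derivative d) (at t within {0..\<sigma>}))}"
    proof (rule negligible_subset)
      show "negligible (N \<union> {0, \<sigma>})" using N(2) by simp
    qed (use * in \<open>fastforce simp: order_le_less\<close>)
    then show "AE t in lebesgue_on {0..\<sigma>}. \<exists>d\<ge>m. ((\<lambda>t. u \<bullet> x t) has_vector_derivative d) (at t within {0..\<sigma>})"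
      by (simp add: AE_lebesgue_on_iff_negligible)
  qed
  then show ?thesis by (simp add: inner_diff_right)
qed

text \<open>The scalar estimate is used in the direction opposite to the increment \<open>u\<close>
  itself, which bounds the square of \<open>norm u\<close>; one factor cancels.\<close>

lemma trajectory_norm_le:
  assumes tr: "is_trajectory F 0 \<sigma> x" and \<sigma>: "0 \<le> \<sigma>" and M: "0 \<le> M"
    and le: "\<And>t v. 0 < t \<Longrightarrow> t < \<sigma> \<Longrightarrow> v \<in> F (x t) \<Longrightarrow> norm v \<le> M"
  shows "norm (x \<sigma> - x 0) \<le> M * \<sigma>"
proof -
  define u where "u = x \<sigma> - x 0"
  have "- (norm u * M) * \<sigma> \<le> (- u) \<bullet> (x \<sigma> - x 0)"
  proof (rule trajectory_inner_ge[OF tr \<sigma>])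
    fix t v assume "0 < t" "t < \<sigma>" "v \<in> F (x t)"
    then have "norm u * norm v \<le> norm u * M" using le by (intro mult_left_mono) auto
    then show "- (norm u * M) \<le> (- u) \<bullet> v" using norm_cauchy_schwarz[of u v] by simp
  qed
  then have "norm u * norm u \<le> norm u * (M * \<sigma>)"
    by (simp add: u_def[symmetric] power2_norm_eq_inner[symmetric] power2_eq_square mult.assoc)
  then show ?thesis using M \<sigma> unfolding u_def[symmetric]
    by (cases "norm u = 0") (auto simp: mult_le_cancel_left)
qed

text \<open>First exit time: the ball is open, so the times spent outside form a closed set and
  their infimum is one of them. Before it the speed bound holds, and the distance covered is too
  short to have left the ball.\<close>

lemma trajectory_stays_in_ball:
  assumes tr: "is_trajectory F 0 \<sigma> x" and M: "0 \<le> M"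
    and le: "\<And>y v. y \<in> ball \<alpha> \<rho> \<Longrightarrow> v \<in> F y \<Longrightarrow> norm v \<le> M"
    and \<rho>: "norm (x 0 - \<alpha>) + M * \<sigma> < \<rho>" and t: "0 \<le> t" "t \<le> \<sigma>"
  shows "x t \<in> ball \<alpha> \<rho>"
proof (rule ccontr)
  assume nt: "x t \<notin> ball \<alpha> \<rho>"
  have cont: "continuous_on {0..\<sigma>} x"
    using tr abs_continuous_on_imp_continuous_on unfolding is_trajectory_def by blast
  define S where "S = {0..\<sigma>} \<inter> x -` (- ball \<alpha> \<rho>)"
  have "closed S" unfolding S_def
    by (rule continuous_closed_preimage[OF cont]) (auto simp: closed_Compl)
  moreover have "S \<noteq> {}" "bdd_below S" using nt t by (auto simp: S_def bdd_below_def)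
  ultimately have t0: "Inf S \<in> S" using closed_contains_Inf by blast
  define t0 where "t0 = Inf S"
  have t0S: "0 \<le> t0" "t0 \<le> \<sigma>" "x t0 \<notin> ball \<alpha> \<rho>" using t0 by (auto simp: S_def t0_def)
  have before: "x s \<in> ball \<alpha> \<rho>" if "0 < s" "s < t0" for s
  proof (rule ccontr)
    assume "x s \<notin> ball \<alpha> \<rho>"
    then have "s \<in> S" using that t0S by (auto simp: S_def)
    then show False using that cInf_lower[of s S] \<open>bdd_below S\<close> by (simp add: t0_def)
  qed
  have "is_trajectory F 0 t0 x" using is_trajectory_shift[OF tr, of 0 0 t0] t0S by simp
  then have "norm (x t0 - x 0) \<le> M * t0"
    by (rule trajectory_norm_le) (use M t0S before le in blast)+
  also have "\<dots> \<le> M * \<sigma>" using M t0S by (simp add: mult_left_mono)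
  finally have "norm (x t0 - \<alpha>) < \<rho>" using \<rho> norm_triangle_ineq[of "x t0 - x 0" "x 0 - \<alpha>"] by simp
  then show False using t0S(3) by (simp add: dist_norm norm_minus_commute)
qed

section \<open>Existence of trajectories with prescribed initial velocity\<close>

text \<open>The nearest point is nonexpansive in the projected point, but its dependence on the set
  is estimated only with exponent 1/2, whence the square root. Continuity survives, and this is what
  makes the Filippov iterates integrable.\<close>

lemma continuous_on_closest_point_lipschitz:
  fixes G :: "'a::real_normed_vector \<Rightarrow> 'b::euclidean_space set"
  assumes G: "\<And>x. G x \<noteq> {}" "\<And>x. closed (G x)" "\<And>x. convex (G x)"
    and lip: "\<And>x y v. v \<in> G x \<Longrightarrow> \<exists>w\<in>G y. norm (v - w) \<le> L * norm (x - y)"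
    and X: "continuous_on S X" and V: "continuous_on S V"
  shows "continuous_on S (\<lambda>t. closest_point (G (X t)) (V t))"
proof -
  let ?P = "\<lambda>x. closest_point (G x)"
  have sq: "(norm (?P x v - ?P x' v))\<^sup>2 \<le>
      L * norm (x - x') * (2 * norm (v - ?P x v) + L * norm (x - x'))" for x x' v
  proof -
    define p p' where "p = ?P x v" and "p' = ?P x' v"
    have p: "p \<in> G x" "p' \<in> G x'" unfolding p_def p'_def using G by (auto intro: closest_point_in_set)
    obtain q where q: "q \<in> G x" "norm (p' - q) \<le> L * norm (x - x')"
      using lip[OF p(2)] by (metis norm_minus_commute)
    obtain q' where q': "q' \<in> G x'" "norm (p - q') \<le> L * norm (x - x')" using lip[OF p(1)] by blast
    \<comment> \<open>The nearest point of one set need not lie in the other set. The obtuse-angle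
      inequalities are therefore tested against the nearby substitutes \<open>q\<close> and
      \<open>q'\<close>, and the substitution errors are all that remains of the squared
      distance.\<close>
    have d: "(v - p) \<bullet> (q - p) \<le> 0" "(v - p') \<bullet> (q' - p') \<le> 0"
      unfolding p_def p'_def using closest_point_dot G q(1) q'(1) by blast+
    have "norm (v - p') \<le> norm (v - q')"
      using closest_point_le[OF G(2) q'(1), of v] by (simp add: p'_def dist_norm)
    also have "\<dots> \<le> norm (v - p) + norm (p - q')" using norm_triangle_ineq[of "v - p" "p - q'"] by simp
    finally have vp': "norm (v - p') \<le> norm (v - p) + L * norm (x - x')" using q' by linarith
    have "(norm (p - p'))\<^sup>2 = (v - p) \<bullet> (q - p) + (v - p) \<bullet> (p' - q) + ((v - p') \<bullet> (q' - p') + (v - p') \<bullet> (p - q'))"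
      by (simp add: power2_norm_eq_inner inner_diff_left inner_diff_right inner_commute)
    also have "\<dots> \<le> norm (v - p) * norm (p' - q) + norm (v - p') * norm (p - q')"
      using d norm_cauchy_schwarz[of "v - p" "p' - q"] norm_cauchy_schwarz[of "v - p'" "p - q'"] by linarith
    also have "\<dots> \<le> norm (v - p) * (L * norm (x - x')) + (norm (v - p) + L * norm (x - x')) * (L * norm (x - x'))"
      using q q' vp' by (intro add_mono mult_mono) (auto intro: order_trans[OF norm_ge_zero])
    finally show ?thesis unfolding p_def p'_def by (simp add: algebra_simps)
  qed
  have est: "norm (?P x v - ?P x' v') \<le>
      norm (v - v') + sqrt (L * norm (x - x') * (2 * norm (v - ?P x v) + L * norm (x - x')))" for x x' v v'
  proof -
    have "norm (?P x v - ?P x' v') \<le> norm (?P x v - ?P x' v) + norm (?P x' v - ?P x' v')"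
      using norm_triangle_ineq[of "?P x v - ?P x' v" "?P x' v - ?P x' v'"] by simp
    moreover have "norm (?P x' v - ?P x' v') \<le> norm (v - v')"
      using closest_point_lipschitz[OF G(3,2,1), of x' v v'] by (simp add: dist_norm)
    ultimately show ?thesis using real_le_rsqrt[OF sq[of x v x']] by linarith
  qed
  show ?thesis unfolding continuous_on_def
  proof
    fix s assume s: "s \<in> S"
    let ?b = "\<lambda>t. norm (V s - V t) + sqrt (L * norm (X s - X t) * (2 * norm (V s - ?P (X s) (V s)) + L * norm (X s - X t)))"
    have XV: "(X \<longlongrightarrow> X s) (at s within S)" "(V \<longlongrightarrow> V s) (at s within S)"
      using X V s by (auto simp: continuous_on_def)
    have "(?b \<longlongrightarrow> norm (V s - V s) + sqrt (L * norm (X s - X s) * (2 * norm (V s - ?P (X s) (V s)) + L * norm (X s - X s)))) (at s within S)"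
      by (intro tendsto_intros XV)
    then have b0: "(?b \<longlongrightarrow> 0) (at s within S)" by simp
    have "((\<lambda>t. ?P (X t) (V t) - ?P (X s) (V s)) \<longlongrightarrow> 0) (at s within S)"
      by (rule Lim_null_comparison[OF _ b0])
        (use est[of "X s" "V s"] in \<open>simp add: norm_minus_commute\<close>)
    then show "((\<lambda>t. ?P (X t) (V t)) \<longlongrightarrow> ?P (X s) (V s)) (at s within S)"
      by (simp add: LIM_zero_iff)
  qed
qed

text \<open>Filippov's successive approximations: the next velocity is the projection of the current one
  onto the values of the inclusion along the current curve, which keeps every iterate continuous.\<close>

lemma filippov_solution:
  fixes G :: "'a::euclidean_space \<Rightarrow> 'a set"
  assumes G: "\<And>x. G x \<noteq> {}" "\<And>x. closed (G x)" "\<And>x. convex (G x)"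
    and lip: "\<And>x y v. v \<in> G x \<Longrightarrow> \<exists>w\<in>G y. norm (v - w) \<le> L * norm (x - y)"
    and L: "0 \<le> L" "L * \<tau> \<le> 1 / 2"
    and C: "\<And>t. t \<in> {0..\<tau>} \<Longrightarrow> \<exists>u\<in>G (y + t *\<^sub>R w). norm (w - u) \<le> C"
  obtains v where "continuous_on {0..\<tau>} v"
    "\<And>t. t \<in> {0..\<tau>} \<Longrightarrow> v t \<in> G (y + integral {0..t} v)"
    "\<And>t. t \<in> {0..\<tau>} \<Longrightarrow> norm (v t - w) \<le> 2 * C"
proof -
  \<comment> \<open>The recursion runs on velocities, starting from the constant \<open>w\<close>;
    the curves \<open>X k\<close> are recovered by integration. Continuous velocities allow
    membership to be stated at every time.\<close>
  define V where "V = rec_nat (\<lambda>_::real. w) (\<lambda>_ f t. closest_point (G (y + integral {0..t} f)) (f t))"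
  define X where "X k t = y + integral {0..t} (V k)" for k t
  have V0: "V 0 t = w" and VS: "V (Suc k) t = closest_point (G (X k t)) (V k t)" for k t
    by (simp_all add: V_def X_def)
  have cont: "continuous_on {0..\<tau>} (V k)" for k
  proof (induction k)
    case 0 then show ?case by (simp add: V0)
  next
    case (Suc k)
    have "continuous_on {0..\<tau>} (X k)" unfolding X_def
      by (intro continuous_intros indefinite_integral_continuous_1 integrable_continuous_real Suc)
    then show ?case unfolding VS
      by (intro continuous_on_closest_point_lipschitz[where G = G and L = L] G lip Suc)
  qed
  have int: "V k integrable_on {0..t}" if "t \<in> {0..\<tau>}" for k t
    using that by (intro integrable_continuous_real continuous_on_subset[OF cont]) auto
  have mem: "V (Suc k) t \<in> G (X k t)" for k t unfolding VS using G by (auto intro: closest_point_in_set)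
  have near: "norm (closest_point (G x) v - v) \<le> norm (v - u)" if "u \<in> G x" for x v u
    using closest_point_le[OF G(2) that, of v] by (simp add: dist_norm norm_minus_commute)
  \<comment> \<open>\<open>C\<close> measures how far the straight line is from being a solution. A
    round multiplies the discrepancy by at most L * \<tau>, hence by 1 / 2: integration contributes
    the time, projection the Lipschitz constant.\<close>
  have diff: "norm (V (Suc k) t - V k t) \<le> C / 2 ^ k" if "t \<in> {0..\<tau>}" for k t
    using that
  proof (induction k arbitrary: t)
    case 0
    then have "X 0 t = y + t *\<^sub>R w" by (simp add: X_def V0 cong: integral_cong)
    then show ?case using C[OF 0] near unfolding VS V0 by (auto intro: order_trans)
  next
    case (Suc k)
    have "norm (X k t - X (Suc k) t) = norm (integral {0..t} (\<lambda>s. V (Suc k) s - V k s))"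
      using int[OF Suc.prems] by (simp add: X_def integral_diff norm_minus_commute)
    also have "\<dots> \<le> C / 2 ^ k * (t - 0)"
    proof (rule integral_bound)
      show "continuous_on {0..t} (\<lambda>s. V (Suc k) s - V k s)"
        using Suc.prems by (intro continuous_intros continuous_on_subset[OF cont]) auto
    qed (use Suc in auto)
    finally have X: "norm (X k t - X (Suc k) t) \<le> C / 2 ^ k * t" by simp
    have C0: "0 \<le> C / 2 ^ k" using Suc.IH[OF Suc.prems] norm_ge_zero by (rule order_trans[rotated])
    obtain u where u: "u \<in> G (X (Suc k) t)" "norm (V (Suc k) t - u) \<le> L * norm (X k t - X (Suc k) t)"
      using lip[OF mem] by blast
    have "norm (V (Suc (Suc k)) t - V (Suc k) t) \<le> norm (V (Suc k) t - u)"
      unfolding VS[of "Suc k"] by (rule near[OF u(1)])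
    also have "\<dots> \<le> L * (C / 2 ^ k * t)" using u(2) mult_left_mono[OF X L(1)] by linarith
    also have "\<dots> \<le> L * (C / 2 ^ k * \<tau>)" using Suc.prems C0 L(1) by (intro mult_left_mono) auto
    also have "\<dots> = C / 2 ^ k * (L * \<tau>)" by simp
    also have "\<dots> \<le> C / 2 ^ k * (1 / 2)" by (rule mult_left_mono[OF L(2) C0])
    finally show ?case by simp
  qed
  define v where "v t = w + (\<Sum>i. V (Suc i) t - V i t)" for t
  have "uniform_limit {0..\<tau>} (\<lambda>n t. \<Sum>i<n. V (Suc i) t - V i t) (\<lambda>t. \<Sum>i. V (Suc i) t - V i t) sequentially"
  proof (rule Weierstrass_m_test)
    show "summable (\<lambda>k. C / 2 ^ k)"
      using summable_mult[OF summable_geometric[of "1/2::real"], of C] by (simp add: power_divide)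
  qed (rule diff)
  then have "uniform_limit {0..\<tau>} (\<lambda>n t. w + (\<Sum>i<n. V (Suc i) t - V i t)) v sequentially"
    unfolding v_def by (intro uniform_limit_intros)
  moreover have "w + (\<Sum>i<n. V (Suc i) t - V i t) = V n t" for n t
    using sum_lessThan_telescope[of "\<lambda>i. V i t" n] by (simp add: V0)
  ultimately have ul: "uniform_limit {0..\<tau>} V v sequentially" by simp
  have contv: "continuous_on {0..\<tau>} v"
    by (rule uniform_limit_theorem[OF _ ul]) (auto simp: cont)
  show ?thesis
  proof
    fix t assume t: "t \<in> {0..\<tau>}"
    have Vv: "(\<lambda>k. V k t) \<longlonglongrightarrow> v t" by (rule tendsto_uniform_limitI[OF ul t])
    have "uniform_limit {0..t} V v sequentially" by (rule uniform_limit_on_subset[OF ul]) (use t in auto)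
    moreover have "continuous_on {0..t} (V k)" for k by (rule continuous_on_subset[OF cont]) (use t in auto)
    ultimately obtain I J where IJ: "\<And>k. (V k has_integral I k) {0..t}" "(v has_integral J) {0..t}" "I \<longlonglongrightarrow> J"
      by (rule uniform_limit_integral) (simp, blast)
    then have "integral {0..t} (V k) = I k" "integral {0..t} v = J" for k by (auto intro: integral_unique)
    then have Xx: "(\<lambda>k. X k t) \<longlonglongrightarrow> y + integral {0..t} v" (is "_ \<longlonglongrightarrow> ?x")
      using IJ(3) unfolding X_def by (auto intro!: tendsto_intros)
    \<comment> \<open>The iterates lie in varying sets \<open>G (X k t)\<close>. The nearby points
      \<open>u k\<close> lie in the fixed closed set \<open>G ?x\<close> and have the same
      limit.\<close>
    have "\<forall>k. \<exists>u\<in>G ?x. norm (V (Suc k) t - u) \<le> L * norm (X k t - ?x)" using lip[OF mem] by blast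
    then obtain u where u: "\<And>k. u k \<in> G ?x" "\<And>k. norm (V (Suc k) t - u k) \<le> L * norm (X k t - ?x)" by metis
    have "(\<lambda>k. L * norm (X k t - ?x)) \<longlonglongrightarrow> L * norm (?x - ?x)" by (intro tendsto_intros Xx)
    then have z: "(\<lambda>k. L * norm (X k t - ?x)) \<longlonglongrightarrow> 0" by simp
    have "(\<lambda>k. V (Suc k) t - u k) \<longlonglongrightarrow> 0"
      by (rule Lim_null_comparison[OF _ z]) (use u(2) in simp)
    then have "(\<lambda>k. V (Suc k) t - (V (Suc k) t - u k)) \<longlonglongrightarrow> v t - 0"
      by (intro tendsto_diff LIMSEQ_Suc[OF Vv])
    then have "u \<longlonglongrightarrow> v t" by simp
    then show "v t \<in> G ?x" using closed_sequentially[OF G(2)] u(1) by blast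
    \<comment> \<open>The right-hand side is the partial sum of the geometric series, the
      strengthening that carries the induction.\<close>
    have "norm (V k t - w) \<le> 2 * C - 2 * C / 2 ^ k" for k
    proof (induction k)
      case (Suc k)
      have "2 * C / 2 ^ Suc k = C / 2 ^ k" "2 * C / 2 ^ k = 2 * (C / 2 ^ k)" by simp_all
      moreover have "norm (V (Suc k) t - w) \<le> norm (V (Suc k) t - V k t) + norm (V k t - w)"
        using norm_triangle_ineq[of "V (Suc k) t - V k t" "V k t - w"] by simp
      ultimately show ?case using Suc diff[OF t, of k] by linarith
    qed (simp add: V0)
    moreover have "0 \<le> C" using diff[OF t, of 0] norm_ge_zero[of "V (Suc 0) t - V 0 t"] by (simp del: norm_ge_zero)
    ultimately have "norm (V k t - w) \<le> 2 * C" for k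
      by (meson diff_le_eq divide_nonneg_nonneg le_add_same_cancel1 mult_nonneg_nonneg order_trans zero_le_numeral zero_le_power)
    then show "norm (v t - w) \<le> 2 * C"
      by (intro Lim_norm_ubound[OF _ tendsto_diff[OF Vv tendsto_const]]) auto
  qed (rule contv)
qed

section \<open>Locally Lipschitz differential inclusions\<close>

text \<open>The Lipschitz property is kept in pointwise form: a velocity at \<open>x\<close> has a
  close companion at \<open>y\<close>. A locale is used because the results have to be available
  both for \<open>F\<close> and for its negative.\<close>

locale lipschitz_inclusion =
  fixes F :: "'a::euclidean_space \<Rightarrow> 'a set"
  assumes nonempty: "F x \<noteq> {}"
    and compact: "compact (F x)"
    and convex: "convex (F x)"
    and lipschitz: "compact K \<Longrightarrow> \<exists>L. \<forall>x\<in>K. \<forall>y\<in>K. \<forall>v\<in>F x. \<exists>w\<in>F y. norm (v - w) \<le> L * norm (x - y)"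
begin

lemma hamiltonian_le: "v \<in> F x \<Longrightarrow> hamiltonian F x p \<le> p \<bullet> v"
  using hamiltonian_attained[of F x p, OF compact nonempty] by (subst inner_commute) blast

lemma hamiltonian_eqE: obtains v where "v \<in> F x" "hamiltonian F x p = p \<bullet> v"
proof -
  obtain v where "v \<in> F x" "hamiltonian F x p = v \<bullet> p"
    using hamiltonian_attained[of F x p, OF compact nonempty] by blast
  then show thesis by (intro that[of v]) (simp_all add: inner_commute)
qed

text \<open>The constant is made positive, since later radii and durations are obtained by dividing
  by it.\<close>

lemma lipschitz_on_cballE:
  obtains L where "0 < L"
    "\<And>x y v. x \<in> cball \<alpha> 1 \<Longrightarrow> y \<in> cball \<alpha> 1 \<Longrightarrow> v \<in> F x \<Longrightarrow> \<exists>w\<in>F y. norm (v - w) \<le> L * norm (x - y)"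
proof -
  obtain L where L: "\<forall>x\<in>cball \<alpha> 1. \<forall>y\<in>cball \<alpha> 1. \<forall>v\<in>F x. \<exists>w\<in>F y. norm (v - w) \<le> L * norm (x - y)"
    using lipschitz[OF compact_cball] by blast
  have le: "L * norm (x - y) \<le> (\<bar>L\<bar> + 1) * norm (x - y)" for x y :: 'a
    by (rule mult_right_mono) auto
  show thesis
  proof
    show "0 < \<bar>L\<bar> + 1" by simp
    fix x y v assume "x \<in> cball \<alpha> 1" "y \<in> cball \<alpha> 1" "v \<in> F x"
    then obtain w where "w \<in> F y" "norm (v - w) \<le> L * norm (x - y)" using L by blast
    then show "\<exists>w\<in>F y. norm (v - w) \<le> (\<bar>L\<bar> + 1) * norm (x - y)" using le[of x y] by (meson order_trans)
  qed
qed

lemma reverse: "lipschitz_inclusion (\<lambda>x. uminus ` F x)"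
proof
  show "uminus ` F x \<noteq> {}" "compact (uminus ` F x)" "convex (uminus ` F x)" for x
    using nonempty compact convex by (auto intro!: compact_negations simp: convex_negations)
  fix K :: "'a set" assume "compact K"
  then obtain L where L: "\<forall>x\<in>K. \<forall>y\<in>K. \<forall>v\<in>F x. \<exists>w\<in>F y. norm (v - w) \<le> L * norm (x - y)"
    using lipschitz by blast
  have "norm (- v - - w) = norm (v - w)" for v w :: 'a by (metis minus_diff_eq minus_diff_minus norm_minus_cancel)
  then show "\<exists>L. \<forall>x\<in>K. \<forall>y\<in>K. \<forall>v\<in>uminus ` F x. \<exists>w\<in>uminus ` F y. norm (v - w) \<le> L * norm (x - y)"
    using L by (intro exI[of _ L]) (simp add: ball_simps bex_simps)
qed

text \<open>The source of the sign in \<open>hamiltonian F \<beta> (- \<theta>)\<close>: for the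
  reversed inclusion \<open>\<beta>\<close> is the initial point and \<open>\<theta>\<close> the
  normal component there.\<close>

lemma hamiltonian_reverse: "hamiltonian (\<lambda>x. uminus ` F x) x p = hamiltonian F x (- p)"
  unfolding hamiltonian_def by (simp add: image_image)

text \<open>\<open>M\<close> is chosen before \<open>\<epsilon>\<close>: later errors are \<epsilon>
  times a multiple of \<open>M\<close> and vanish only if \<open>M\<close> stays fixed. Velocities
  met near \<open>\<alpha>\<close> are close to \<open>F \<alpha>\<close>, where the Hamiltonian
  bounds the inner products with \<open>\<zeta>\<close> from below.\<close>

lemma short_trajectory_bounds:
  "\<exists>M\<ge>0. \<forall>\<epsilon>>0. \<exists>\<delta>>0. \<forall>x \<sigma>. is_trajectory F 0 \<sigma> x \<longrightarrow> norm (x 0 - \<alpha>) < \<delta> \<longrightarrow> 0 \<le> \<sigma> \<longrightarrow> \<sigma> < \<delta> \<longrightarrow>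
     norm (x \<sigma> - x 0) \<le> M * \<sigma> \<and> (hamiltonian F \<alpha> \<zeta> - \<epsilon>) * \<sigma> \<le> \<zeta> \<bullet> (x \<sigma> - x 0)"
proof -
  obtain L where L: "0 < L"
    "\<And>x y v. x \<in> cball \<alpha> 1 \<Longrightarrow> y \<in> cball \<alpha> 1 \<Longrightarrow> v \<in> F x \<Longrightarrow> \<exists>w\<in>F y. norm (v - w) \<le> L * norm (x - y)"
    by (rule lipschitz_on_cballE[of \<alpha>]) blast
  obtain B where B: "\<And>w. w \<in> F \<alpha> \<Longrightarrow> norm w \<le> B" "0 < B"
    using compact_imp_bounded[OF compact, of \<alpha>] unfolding bounded_pos by blast
  \<comment> \<open>Speed bound on the unit ball: \<open>B\<close> on \<open>F \<alpha>\<close>,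
    plus \<open>L\<close> for a distance of at most 1.\<close>
  define M where "M = B + L"
  have M0: "0 < M" using B L by (simp add: M_def)
  have M: "norm v \<le> M" if y: "y \<in> cball \<alpha> 1" and v: "v \<in> F y" for y v
  proof -
    obtain w where "w \<in> F \<alpha>" "norm (v - w) \<le> L * norm (y - \<alpha>)" using L(2)[OF y _ v, of \<alpha>] by auto
    moreover have "L * norm (y - \<alpha>) \<le> L * 1"
      using y L(1) by (intro mult_left_mono) (auto simp: dist_norm norm_minus_commute)
    ultimately show ?thesis using B(1)[of w] norm_triangle_ineq[of "v - w" w] by (simp add: M_def)
  qed
  show ?thesis
  proof (rule exI[of _ M], intro conjI allI impI)
    show "0 \<le> M" using M0 by simp
    fix \<epsilon> :: real assume \<epsilon>: "0 < \<epsilon>"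
    \<comment> \<open>Within radius \<open>\<rho>\<close> a velocity deviates from
      \<open>F \<alpha>\<close> by at most L * \<rho>, which costs at most \<open>\<epsilon>\<close>
      in the direction \<open>\<zeta>\<close>.\<close>
    define \<rho> where "\<rho> = min 1 (\<epsilon> / (L * (norm \<zeta> + 1)))"
    have den: "0 < L * (norm \<zeta> + 1)" using L(1) by (intro mult_pos_pos) (auto intro: add_nonneg_pos)
    have \<rho>: "0 < \<rho>" "\<rho> \<le> 1" using \<epsilon> den by (auto simp: \<rho>_def)
    have "\<rho> \<le> \<epsilon> / (L * (norm \<zeta> + 1))" by (simp add: \<rho>_def)
    then have "\<rho> * (L * (norm \<zeta> + 1)) \<le> \<epsilon>" using den by (simp add: pos_le_divide_eq)
    moreover have "norm \<zeta> * (L * \<rho>) \<le> \<rho> * (L * (norm \<zeta> + 1))" using L(1) \<rho>(1) by (simp add: algebra_simps)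
    ultimately have \<rho>\<epsilon>: "norm \<zeta> * (L * \<rho>) \<le> \<epsilon>" by linarith
    \<comment> \<open>Half of the radius is reserved for the offset of the starting point, half for
      the distance travelled.\<close>
    define \<delta> where "\<delta> = min (\<rho> / 2) (\<rho> / (2 * M))"
    have \<delta>: "0 < \<delta>" "\<delta> \<le> \<rho> / 2" "M * \<delta> \<le> \<rho> / 2"
      using \<rho> M0 by (auto simp: \<delta>_def min_def field_simps)
    show "\<exists>\<delta>>0. \<forall>x \<sigma>. is_trajectory F 0 \<sigma> x \<longrightarrow> norm (x 0 - \<alpha>) < \<delta> \<longrightarrow> 0 \<le> \<sigma> \<longrightarrow> \<sigma> < \<delta> \<longrightarrow>
       norm (x \<sigma> - x 0) \<le> M * \<sigma> \<and> (hamiltonian F \<alpha> \<zeta> - \<epsilon>) * \<sigma> \<le> \<zeta> \<bullet> (x \<sigma> - x 0)"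
    proof (intro exI[of _ \<delta>] conjI allI impI \<delta>(1))
      fix x \<sigma> assume tr: "is_trajectory F 0 \<sigma> x" and x0: "norm (x 0 - \<alpha>) < \<delta>" and \<sigma>: "0 \<le> \<sigma>" "\<sigma> < \<delta>"
      have "M * \<sigma> \<le> M * \<delta>" using M0 \<sigma> by simp
      then have lt: "norm (x 0 - \<alpha>) + M * \<sigma> < \<rho>" using x0 \<delta> by linarith
      have M\<rho>: "norm v \<le> M" if "y \<in> ball \<alpha> \<rho>" "v \<in> F y" for y v
        using M[of y v] that \<rho>(2) by auto
      have inball: "x t \<in> ball \<alpha> \<rho>" if "0 < t" "t < \<sigma>" for t
        by (rule trajectory_stays_in_ball[OF tr _ M\<rho> lt]) (use M0 that in auto)
      then have incball: "x t \<in> cball \<alpha> 1" if "0 < t" "t < \<sigma>" for t using that \<rho>(2) by fastforce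
      show "norm (x \<sigma> - x 0) \<le> M * \<sigma>"
        by (rule trajectory_norm_le[OF tr \<sigma>(1)]) (use M M0 incball in auto)
      show "(hamiltonian F \<alpha> \<zeta> - \<epsilon>) * \<sigma> \<le> \<zeta> \<bullet> (x \<sigma> - x 0)"
      proof (rule trajectory_inner_ge[OF tr \<sigma>(1)])
        fix t v assume t: "0 < t" "t < \<sigma>" "v \<in> F (x t)"
        obtain w where w: "w \<in> F \<alpha>" "norm (v - w) \<le> L * norm (x t - \<alpha>)"
          using L(2)[OF incball[OF t(1,2)] _ t(3), of \<alpha>] by auto
        have "norm (x t - \<alpha>) \<le> \<rho>" using inball[OF t(1,2)] by (simp add: dist_norm norm_minus_commute)
        then have "norm (v - w) \<le> L * \<rho>" using w(2) L(1) by (meson mult_left_mono order_trans less_imp_le)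
        then have "norm \<zeta> * norm (v - w) \<le> norm \<zeta> * (L * \<rho>)" by (rule mult_left_mono) simp
        moreover have "- (\<zeta> \<bullet> (v - w)) \<le> norm \<zeta> * norm (v - w)"
          using Cauchy_Schwarz_ineq2[of \<zeta> "v - w"] by linarith
        ultimately show "hamiltonian F \<alpha> \<zeta> - \<epsilon> \<le> \<zeta> \<bullet> v"
          using \<rho>\<epsilon> hamiltonian_le[OF w(1), of \<zeta>] by (simp add: inner_diff_right)
      qed
    qed
  qed
qed

text \<open>Here \<open>x'\<close> lies on a nearly optimal trajectory from \<open>x\<close> to \<open>y\<close>, at time \<open>s'\<close>.\<close>

lemma cut_initial_piece:
  obtains M where "0 \<le> M"
    "\<And>\<epsilon>. 0 < \<epsilon> \<Longrightarrow> \<exists>\<delta>>0. \<forall>x y \<rho> s. norm (x - \<alpha>) < \<delta> \<longrightarrow> 0 \<le> s \<longrightarrow> s < \<delta> \<longrightarrow> 0 \<le> \<rho> \<longrightarrow>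
      min_time F x y < ereal (\<rho> + s) \<longrightarrow>
      (\<exists>x' s'. 0 \<le> s' \<and> s' \<le> s \<and> min_time F x y \<le> ereal (\<rho> + s') \<and> min_time F x' y \<le> ereal \<rho> \<and>
        norm (x' - x) \<le> M * s' \<and> (hamiltonian F \<alpha> \<zeta> - \<epsilon>) * s' \<le> \<zeta> \<bullet> (x' - x))"
proof -
  obtain M where M: "0 \<le> M" "\<forall>\<epsilon>>0. \<exists>\<delta>>0. \<forall>x \<sigma>. is_trajectory F 0 \<sigma> x \<longrightarrow> norm (x 0 - \<alpha>) < \<delta> \<longrightarrow> 0 \<le> \<sigma> \<longrightarrow> \<sigma> < \<delta> \<longrightarrow>
     norm (x \<sigma> - x 0) \<le> M * \<sigma> \<and> (hamiltonian F \<alpha> \<zeta> - \<epsilon>) * \<sigma> \<le> \<zeta> \<bullet> (x \<sigma> - x 0)"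
    using short_trajectory_bounds[of \<alpha> \<zeta>] by blast
  show thesis
  proof (rule that[OF M(1)])
    fix \<epsilon> :: real assume "0 < \<epsilon>"
    then obtain \<delta> where \<delta>: "0 < \<delta>"
      "\<forall>x \<sigma>. is_trajectory F 0 \<sigma> x \<longrightarrow> norm (x 0 - \<alpha>) < \<delta> \<longrightarrow> 0 \<le> \<sigma> \<longrightarrow> \<sigma> < \<delta> \<longrightarrow>
       norm (x \<sigma> - x 0) \<le> M * \<sigma> \<and> (hamiltonian F \<alpha> \<zeta> - \<epsilon>) * \<sigma> \<le> \<zeta> \<bullet> (x \<sigma> - x 0)"
      using M(2) by blast
    show "\<exists>\<delta>>0. \<forall>x y \<rho> s. norm (x - \<alpha>) < \<delta> \<longrightarrow> 0 \<le> s \<longrightarrow> s < \<delta> \<longrightarrow> 0 \<le> \<rho> \<longrightarrow>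
      min_time F x y < ereal (\<rho> + s) \<longrightarrow>
      (\<exists>x' s'. 0 \<le> s' \<and> s' \<le> s \<and> min_time F x y \<le> ereal (\<rho> + s') \<and> min_time F x' y \<le> ereal \<rho> \<and>
        norm (x' - x) \<le> M * s' \<and> (hamiltonian F \<alpha> \<zeta> - \<epsilon>) * s' \<le> \<zeta> \<bullet> (x' - x))"
    proof (rule exI[of _ \<delta>], intro conjI allI impI \<delta>(1))
      fix x y \<rho> s
      assume x: "norm (x - \<alpha>) < \<delta>" and s: "0 \<le> s" "s < \<delta>" and \<rho>: "0 \<le> \<rho>"
        and "min_time F x y < ereal (\<rho> + s)"
      then obtain \<sigma> z where z: "0 \<le> \<sigma>" "\<sigma> < \<rho> + s" "is_trajectory F 0 \<sigma> z" "z 0 = x" "z \<sigma> = y"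
        by (elim min_time_lessE)
      have T: "min_time F x y \<le> ereal \<sigma>" by (rule min_time_le[OF z(3,1,4,5)])
      show "\<exists>x' s'. 0 \<le> s' \<and> s' \<le> s \<and> min_time F x y \<le> ereal (\<rho> + s') \<and> min_time F x' y \<le> ereal \<rho> \<and>
        norm (x' - x) \<le> M * s' \<and> (hamiltonian F \<alpha> \<zeta> - \<epsilon>) * s' \<le> \<zeta> \<bullet> (x' - x)"
      \<comment> \<open>If the trajectory fits into time \<open>\<rho>\<close>, nothing is cut.
        Otherwise exactly \<sigma> - \<rho> is cut off. The inequality between
        \<open>min_time F x y\<close> and \<rho> + s' bounds \<open>s'\<close> from below whenever
        the minimal time is known.\<close>
      proof (cases "\<sigma> \<le> \<rho>")
        case True
        then have "min_time F x y \<le> ereal \<rho>" using T by (meson ereal_less_eq(3) order_trans)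
        then show ?thesis using s by (intro exI[of _ x] exI[of _ 0]) auto
      next
        case False
        have "is_trajectory F 0 (\<sigma> - \<rho>) z" using is_trajectory_shift[OF z(3), of 0 0 "\<sigma> - \<rho>"] \<rho> by simp
        then have "norm (z (\<sigma> - \<rho>) - x) \<le> M * (\<sigma> - \<rho>)"
          "(hamiltonian F \<alpha> \<zeta> - \<epsilon>) * (\<sigma> - \<rho>) \<le> \<zeta> \<bullet> (z (\<sigma> - \<rho>) - x)"
          using \<delta>(2)[rule_format, of "\<sigma> - \<rho>" z] False x z s by auto
        moreover have "is_trajectory F 0 \<rho> (\<lambda>t. z (t + (\<sigma> - \<rho>)))"
          by (rule is_trajectory_shift[OF z(3)]) (use False in auto)
        then have "min_time F (z (\<sigma> - \<rho>)) y \<le> ereal \<rho>"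
          by (rule min_time_le) (use \<rho> z(5) in auto)
        ultimately show ?thesis using False z(2) T
          by (intro exI[of _ "z (\<sigma> - \<rho>)"] exI[of _ "\<sigma> - \<rho>"]) auto
      qed
    qed
  qed
qed

text \<open>Away from \<open>\<beta>\<close> the velocity \<open>w\<close> need not be admissible,
  so the straight line is corrected by Filippov's construction. Uniformity in \<open>y\<close>
  matters because extensions are also attached at points near \<open>\<beta>\<close>.\<close>

lemma reachable_in_direction:
  assumes w: "w \<in> F \<beta>" and \<epsilon>: "0 < \<epsilon>"
  obtains \<delta> where "0 < \<delta>"
    "\<And>y \<tau>. norm (y - \<beta>) < \<delta> \<Longrightarrow> 0 \<le> \<tau> \<Longrightarrow> \<tau> < \<delta> \<Longrightarrow>
      \<exists>y'. norm (y' - y - \<tau> *\<^sub>R w) \<le> \<epsilon> * \<tau> \<and> min_time F y y' \<le> ereal \<tau>"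
proof -
  define K where "K = cball \<beta> 1"
  obtain L where L: "0 < L"
    "\<And>x y v. x \<in> K \<Longrightarrow> y \<in> K \<Longrightarrow> v \<in> F x \<Longrightarrow> \<exists>w\<in>F y. norm (v - w) \<le> L * norm (x - y)"
    unfolding K_def by (rule lipschitz_on_cballE[of \<beta>]) blast
  have K: "closed K" "convex K" "K \<noteq> {}" "\<beta> \<in> K" by (auto simp: K_def)
  \<comment> \<open>Composition with the projection onto \<open>K\<close> turns the Lipschitz
    constant on \<open>K\<close> into a global one, as the construction requires. Short curves stay
    in \<open>K\<close>, where \<open>G\<close> agrees with \<open>F\<close>.\<close>
  define G where "G x = F (closest_point K x)" for x
  have G: "G x \<noteq> {}" "closed (G x)" "convex (G x)" for x
    unfolding G_def using nonempty compact_imp_closed[OF compact] convex by auto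
  have GF: "G x = F x" if "x \<in> K" for x using that by (simp add: G_def closest_point_self)
  have lipG: "\<exists>w\<in>G y. norm (v - w) \<le> L * norm (x - y)" if v: "v \<in> G x" for x y v
  proof -
    obtain u where u: "u \<in> G y" "norm (v - u) \<le> L * norm (closest_point K x - closest_point K y)"
      using L(2)[of "closest_point K x" "closest_point K y" v] v K closest_point_in_set
      unfolding G_def by blast
    moreover have "norm (closest_point K x - closest_point K y) \<le> norm (x - y)"
      using closest_point_lipschitz[OF K(2,1,3), of x y] by (simp add: dist_norm)
    ultimately show ?thesis using L(1) by (meson mult_left_mono order_trans less_imp_le)
  qed
  \<comment> \<open>The three terms ensure, in this order, L * \<tau> \<le> 1 / 2, that the curve
    stays in \<open>K\<close>, and 2 * C \<le> \<epsilon>.\<close>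
  define \<delta> where "\<delta> = min (1 / (2 * L)) (min (1 / (1 + norm w + \<epsilon>)) (\<epsilon> / (2 * L * (1 + norm w))))"
  have w1: "0 < 1 + norm w" "0 < 1 + norm w + \<epsilon>" using \<epsilon> norm_ge_zero[of w] by linarith+
  have \<delta>: "0 < \<delta>" using L(1) \<epsilon> w1 by (simp add: \<delta>_def)
  have "\<delta> \<le> 1 / (2 * L)" "\<delta> \<le> 1 / (1 + norm w + \<epsilon>)" "\<delta> \<le> \<epsilon> / (2 * L * (1 + norm w))" by (auto simp: \<delta>_def)
  then have \<delta>': "\<delta> * (2 * L) \<le> 1" "\<delta> * (1 + norm w + \<epsilon>) \<le> 1" "\<delta> * (2 * L * (1 + norm w)) \<le> \<epsilon>"
    using L(1) w1 by (simp_all add: pos_le_divide_eq)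
  show thesis
  proof (rule that[OF \<delta>])
    fix y \<tau> assume y: "norm (y - \<beta>) < \<delta>" and \<tau>: "0 \<le> \<tau>" "\<tau> < \<delta>"
    \<comment> \<open>Defect of the straight line: it stays within \<delta> * (1 + norm w) of
      \<open>\<beta>\<close>, where \<open>w\<close> is admissible.\<close>
    define C where "C = L * (\<delta> * (1 + norm w))"
    have C: "2 * C \<le> \<epsilon>" using \<delta>'(3) by (simp add: C_def algebra_simps)
    have ex: "\<exists>u\<in>G (y + t *\<^sub>R w). norm (w - u) \<le> C" if t: "t \<in> {0..\<tau>}" for t
    proof -
      have "w \<in> G \<beta>" using w GF K by simp
      then obtain u where u: "u \<in> G (y + t *\<^sub>R w)" "norm (w - u) \<le> L * norm (\<beta> - (y + t *\<^sub>R w))"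
        using lipG by blast
      have "norm (\<beta> - (y + t *\<^sub>R w)) \<le> norm (y - \<beta>) + norm (t *\<^sub>R w)"
        using norm_triangle_ineq4[of "\<beta> - y" "t *\<^sub>R w"] by (simp add: norm_minus_commute algebra_simps)
      also have "norm (t *\<^sub>R w) \<le> \<delta> * norm w" using t \<tau> by (auto intro: mult_right_mono)
      finally have "norm (\<beta> - (y + t *\<^sub>R w)) \<le> \<delta> * (1 + norm w)" using y by (simp add: algebra_simps)
      then have "L * norm (\<beta> - (y + t *\<^sub>R w)) \<le> C" unfolding C_def using L(1) by simp
      then show ?thesis using u by (meson order_trans)
    qed
    have "2 * (L * \<delta>) \<le> 1" using \<delta>'(1) by (simp add: algebra_simps)
    moreover have "L * \<tau> \<le> L * \<delta>" using \<tau> L(1) by (intro mult_left_mono) auto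
    ultimately have "L * \<tau> \<le> 1 / 2" by linarith
    then obtain v where v: "continuous_on {0..\<tau>} v"
      "\<And>t. t \<in> {0..\<tau>} \<Longrightarrow> v t \<in> G (y + integral {0..t} v)"
      "\<And>t. t \<in> {0..\<tau>} \<Longrightarrow> norm (v t - w) \<le> 2 * C"
      using filippov_solution[OF G lipG less_imp_le[OF L(1)] _ ex] by metis
    define x where "x t = y + integral {0..t} v" for t
    have der: "(x has_vector_derivative v t) (at t within {0..\<tau>})" if "t \<in> {0..\<tau>}" for t
      unfolding x_def using integral_has_vector_derivative[OF v(1) that]
      by (auto intro!: derivative_eq_intros)
    have vb: "norm (v t) \<le> norm w + \<epsilon>" if "t \<in> {0..\<tau>}" for t
      using v(3)[OF that] C norm_triangle_ineq[of "v t - w" w] by simp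
    have lipx: "norm (x t - x s) \<le> (norm w + \<epsilon>) * norm (t - s)" if "s \<in> {0..\<tau>}" "t \<in> {0..\<tau>}" for s t
    proof (rule differentiable_bound[of "{0..\<tau>}" x "\<lambda>t h. h *\<^sub>R v t"])
      show "(x has_derivative (\<lambda>h. h *\<^sub>R v t)) (at t within {0..\<tau>})" if "t \<in> {0..\<tau>}" for t
        using der[OF that] by (simp add: has_vector_derivative_def)
      show "onorm (\<lambda>h. h *\<^sub>R v t) \<le> norm w + \<epsilon>" if "t \<in> {0..\<tau>}" for t
        by (rule onorm_le) (use mult_right_mono[OF vb[OF that] abs_ge_zero] in \<open>simp add: mult.commute\<close>)
    qed (use that in auto)
    have x0: "x 0 = y" by (simp add: x_def)
    have xK: "x t \<in> K" if t: "t \<in> {0..\<tau>}" for t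
    proof -
      have "norm (x t - y) \<le> (norm w + \<epsilon>) * norm (t - 0)" using lipx[of 0 t] t x0 by auto
      also have "\<dots> \<le> (norm w + \<epsilon>) * \<delta>" using t \<tau> \<epsilon> by (intro mult_left_mono) auto
      finally have "norm (x t - \<beta>) \<le> \<delta> * (1 + norm w + \<epsilon>)"
        using y norm_triangle_ineq[of "x t - y" "y - \<beta>"] by (simp add: algebra_simps)
      then show ?thesis using \<delta>'(2) by (simp add: K_def dist_norm norm_minus_commute)
    qed
    have tr: "is_trajectory F 0 \<tau> x"
    proof (rule is_trajectoryI[OF _ negligible_empty])
      show "abs_continuous_on 0 \<tau> x"
        by (rule abs_continuous_on_bound[OF abs_continuous_on_id lipx])
      fix t assume t: "0 < t" "t < \<tau>"
      have "at t within {0..\<tau>} = at t" using t by (intro at_within_interior) auto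
      then show "\<exists>v\<in>F (x t). (x has_vector_derivative v) (at t)"
        using der[of t] v(2)[of t] GF[OF xK[of t]] t by (auto simp: x_def[symmetric])
    qed
    show "\<exists>y'. norm (y' - y - \<tau> *\<^sub>R w) \<le> \<epsilon> * \<tau> \<and> min_time F y y' \<le> ereal \<tau>"
    proof (intro exI[of _ "x \<tau>"] conjI)
      have "x \<tau> - y - \<tau> *\<^sub>R w = integral {0..\<tau>} (\<lambda>t. v t - w)"
        using \<tau> Henstock_Kurzweil_Integration.integral_diff[OF integrable_continuous_real[OF v(1)]
            integrable_const_ivl[of w 0 \<tau>]] by (simp add: x_def)
      also have "norm \<dots> \<le> \<epsilon> * (\<tau> - 0)"
        by (rule integral_bound) (use \<tau> v C in \<open>auto intro!: continuous_intros intro: order_trans\<close>)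
      finally show "norm (x \<tau> - y - \<tau> *\<^sub>R w) \<le> \<epsilon> * \<tau>" by simp
      show "min_time F y (x \<tau>) \<le> ereal \<tau>" by (rule min_time_le[OF tr \<tau>(1) x0 refl])
    qed
  qed
qed

end

text \<open>Having e < 1 lets products of small quantities be absorbed into a fixed multiple of
  \<open>e\<close>.\<close>

lemma le_of_le_add_small_multiple:
  fixes a b C :: real
  assumes "\<And>e. 0 < e \<Longrightarrow> e < 1 \<Longrightarrow> a \<le> b + e * C"
  shows "a \<le> b"
proof (rule field_le_epsilon)
  fix \<eta> :: real assume \<eta>: "0 < \<eta>"
  define e where "e = min (1 / 2) (\<eta> / (\<bar>C\<bar> + 1))"
  have e: "0 < e" "e < 1" using \<eta> by (auto simp: e_def)
  have "e * C \<le> e * (\<bar>C\<bar> + 1)" using e by (intro mult_left_mono) auto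
  also have "\<dots> \<le> \<eta> / (\<bar>C\<bar> + 1) * (\<bar>C\<bar> + 1)" by (intro mult_right_mono) (auto simp: e_def)
  also have "\<dots> = \<eta>" by simp
  finally show "a \<le> b + \<eta>" using assms[OF e] by linarith
qed

section \<open>Normals to the reachable set and to the epigraph\<close>

text \<open>Consequences of normality are drawn in the sum norm. It dominates the Euclidean norm, so
  the neighbourhood shrinks and the error grows, both harmless, and the components can be estimated
  separately.\<close>

lemma reach_set_normalD:
  assumes "(\<zeta>, \<theta>) \<in> frechet_normal_cone (reach_set F r) (\<alpha>, \<beta>)" "0 < \<epsilon>"
  obtains \<delta> where "0 < \<delta>"
    "\<And>x y. min_time F x y \<le> ereal r \<Longrightarrow> norm (x - \<alpha>) + norm (y - \<beta>) < \<delta> \<Longrightarrow>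
      \<zeta> \<bullet> (x - \<alpha>) + \<theta> \<bullet> (y - \<beta>) \<le> \<epsilon> * (norm (x - \<alpha>) + norm (y - \<beta>))"
proof -
  obtain \<delta> where \<delta>: "0 < \<delta>" "\<forall>z\<in>reach_set F r. norm (z - (\<alpha>, \<beta>)) < \<delta> \<longrightarrow>
      (\<zeta>, \<theta>) \<bullet> (z - (\<alpha>, \<beta>)) \<le> \<epsilon> * norm (z - (\<alpha>, \<beta>))"
    using assms unfolding frechet_normal_cone_def by blast
  show thesis
  proof (rule that[OF \<delta>(1)])
    fix x y assume T: "min_time F x y \<le> ereal r" and d: "norm (x - \<alpha>) + norm (y - \<beta>) < \<delta>"
    have n: "norm (x - \<alpha>, y - \<beta>) \<le> norm (x - \<alpha>) + norm (y - \<beta>)" by (rule norm_Pair_le)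
    have "\<zeta> \<bullet> (x - \<alpha>) + \<theta> \<bullet> (y - \<beta>) \<le> \<epsilon> * norm (x - \<alpha>, y - \<beta>)"
      using \<delta>(2)[rule_format, of "(x, y)"] T n d by (simp add: reach_set_def)
    also have "\<dots> \<le> \<epsilon> * (norm (x - \<alpha>) + norm (y - \<beta>))" using n assms(2) by simp
    finally show "\<zeta> \<bullet> (x - \<alpha>) + \<theta> \<bullet> (y - \<beta>) \<le> \<epsilon> * (norm (x - \<alpha>) + norm (y - \<beta>))" .
  qed
qed

lemma epi_min_time_normalD:
  assumes "((\<zeta>, \<theta>), l) \<in> frechet_normal_cone (epi_min_time F) ((\<alpha>, \<beta>), r)" "0 < \<epsilon>"
  obtains \<delta> where "0 < \<delta>"
    "\<And>x y \<mu>. min_time F x y \<le> ereal \<mu> \<Longrightarrow> norm (x - \<alpha>) + norm (y - \<beta>) + \<bar>\<mu> - r\<bar> < \<delta> \<Longrightarrow>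
      \<zeta> \<bullet> (x - \<alpha>) + \<theta> \<bullet> (y - \<beta>) + l * (\<mu> - r) \<le> \<epsilon> * (norm (x - \<alpha>) + norm (y - \<beta>) + \<bar>\<mu> - r\<bar>)"
proof -
  obtain \<delta> where \<delta>: "0 < \<delta>" "\<forall>z\<in>epi_min_time F. norm (z - ((\<alpha>, \<beta>), r)) < \<delta> \<longrightarrow>
      ((\<zeta>, \<theta>), l) \<bullet> (z - ((\<alpha>, \<beta>), r)) \<le> \<epsilon> * norm (z - ((\<alpha>, \<beta>), r))"
    using assms unfolding frechet_normal_cone_def by blast
  show thesis
  proof (rule that[OF \<delta>(1)])
    fix x y \<mu> assume T: "min_time F x y \<le> ereal \<mu>"
      and d: "norm (x - \<alpha>) + norm (y - \<beta>) + \<bar>\<mu> - r\<bar> < \<delta>"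
    have n: "norm ((x - \<alpha>, y - \<beta>), \<mu> - r) \<le> norm (x - \<alpha>) + norm (y - \<beta>) + \<bar>\<mu> - r\<bar>"
      using norm_Pair_le[of "(x - \<alpha>, y - \<beta>)" "\<mu> - r"] norm_Pair_le[of "x - \<alpha>" "y - \<beta>"]
      unfolding real_norm_def by linarith
    have "((x, y), \<mu>) \<in> epi_min_time F"
      using T unfolding epi_min_time_def by (auto intro: le_less_trans)
    then have "\<zeta> \<bullet> (x - \<alpha>) + \<theta> \<bullet> (y - \<beta>) + l * (\<mu> - r) \<le> \<epsilon> * norm ((x - \<alpha>, y - \<beta>), \<mu> - r)"
      using \<delta>(2)[rule_format, of "((x, y), \<mu>)"] n d by simp
    also have "\<dots> \<le> \<epsilon> * (norm (x - \<alpha>) + norm (y - \<beta>) + \<bar>\<mu> - r\<bar>)" using n assms(2) by simp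
    finally show "\<zeta> \<bullet> (x - \<alpha>) + \<theta> \<bullet> (y - \<beta>) + l * (\<mu> - r) \<le>
      \<epsilon> * (norm (x - \<alpha>) + norm (y - \<beta>) + \<bar>\<mu> - r\<bar>)" .
  qed
qed

text \<open>The slice of the epigraph at height \<open>r\<close> is an isometric copy of the
  reachable set, and on it \<open>l\<close> is paired with 0.\<close>

lemma reach_set_normal_of_epi_normal:
  assumes N: "((\<zeta>, \<theta>), l) \<in> frechet_normal_cone (epi_min_time F) ((\<alpha>, \<beta>), r)"
  shows "(\<zeta>, \<theta>) \<in> frechet_normal_cone (reach_set F r) (\<alpha>, \<beta>)"
  unfolding frechet_normal_cone_def
proof (intro CollectI allI impI)
  fix \<epsilon> :: real assume "0 < \<epsilon>"
  then obtain \<delta> where \<delta>: "0 < \<delta>" "\<forall>z\<in>epi_min_time F. norm (z - ((\<alpha>, \<beta>), r)) < \<delta> \<longrightarrow>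
      ((\<zeta>, \<theta>), l) \<bullet> (z - ((\<alpha>, \<beta>), r)) \<le> \<epsilon> * norm (z - ((\<alpha>, \<beta>), r))"
    using N unfolding frechet_normal_cone_def by blast
  show "\<exists>\<delta>>0. \<forall>y\<in>reach_set F r. norm (y - (\<alpha>, \<beta>)) < \<delta> \<longrightarrow>
      (\<zeta>, \<theta>) \<bullet> (y - (\<alpha>, \<beta>)) \<le> \<epsilon> * norm (y - (\<alpha>, \<beta>))"
  proof (intro exI[of _ \<delta>] conjI ballI impI \<delta>(1))
    fix z assume z: "z \<in> reach_set F r" "norm (z - (\<alpha>, \<beta>)) < \<delta>"
    then have "(z, r) \<in> epi_min_time F"
      by (auto simp: reach_set_def epi_min_time_def intro: le_less_trans)
    moreover have "norm ((z, r) - ((\<alpha>, \<beta>), r)) = norm (z - (\<alpha>, \<beta>))" by (simp add: norm_Pair)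
    moreover have "((\<zeta>, \<theta>), l) \<bullet> ((z, r) - ((\<alpha>, \<beta>), r)) = (\<zeta>, \<theta>) \<bullet> (z - (\<alpha>, \<beta>))" by simp
    ultimately show "(\<zeta>, \<theta>) \<bullet> (z - (\<alpha>, \<beta>)) \<le> \<epsilon> * norm (z - (\<alpha>, \<beta>))"
      using \<delta>(2) z(2) by metis
  qed
qed

text \<open>The epigraph contains the vertical ray above the point, and moving up along it tests the
  sign of \<open>l\<close>.\<close>

lemma epi_normal_nonpos:
  assumes T: "min_time F \<alpha> \<beta> = ereal r"
    and N: "((\<zeta>, \<theta>), l) \<in> frechet_normal_cone (epi_min_time F) ((\<alpha>, \<beta>), r)"
  shows "l \<le> 0"
proof (rule field_le_epsilon)
  fix e :: real assume e: "0 < e"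
  obtain \<delta> where \<delta>: "0 < \<delta>"
    "\<And>x y \<mu>. min_time F x y \<le> ereal \<mu> \<Longrightarrow> norm (x - \<alpha>) + norm (y - \<beta>) + \<bar>\<mu> - r\<bar> < \<delta> \<Longrightarrow>
      \<zeta> \<bullet> (x - \<alpha>) + \<theta> \<bullet> (y - \<beta>) + l * (\<mu> - r) \<le> e * (norm (x - \<alpha>) + norm (y - \<beta>) + \<bar>\<mu> - r\<bar>)"
    by (rule epi_min_time_normalD[OF N e]) blast
  have "l * (\<delta> / 2) \<le> e * (\<delta> / 2)" using \<delta>(2)[of \<alpha> \<beta> "r + \<delta> / 2"] \<delta>(1) by (simp add: T)
  then show "l \<le> 0 + e" using \<delta>(1) by simp
qed

text \<open>Swapping the components is an isometry that carries one reachable set onto the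
  other.\<close>

lemma reach_set_normal_reverse:
  assumes "(\<zeta>, \<theta>) \<in> frechet_normal_cone (reach_set F r) (\<alpha>, \<beta>)"
  shows "(\<theta>, \<zeta>) \<in> frechet_normal_cone (reach_set (\<lambda>x. uminus ` F x) r) (\<beta>, \<alpha>)"
  unfolding frechet_normal_cone_def
proof (intro CollectI allI impI)
  fix \<epsilon> :: real assume "0 < \<epsilon>"
  then obtain \<delta> where \<delta>: "0 < \<delta>" "\<forall>z\<in>reach_set F r. norm (z - (\<alpha>, \<beta>)) < \<delta> \<longrightarrow>
      (\<zeta>, \<theta>) \<bullet> (z - (\<alpha>, \<beta>)) \<le> \<epsilon> * norm (z - (\<alpha>, \<beta>))"
    using assms unfolding frechet_normal_cone_def by blast
  have "(\<theta>, \<zeta>) \<bullet> ((y, x) - (\<beta>, \<alpha>)) \<le> \<epsilon> * norm ((y, x) - (\<beta>, \<alpha>))"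
    if "(y, x) \<in> reach_set (\<lambda>x. uminus ` F x) r" "norm ((y, x) - (\<beta>, \<alpha>)) < \<delta>" for y x
    using that \<delta>(2)[rule_format, of "(x, y)"]
    by (simp add: reach_set_def min_time_reverse norm_Pair add.commute)
  then show "\<exists>\<delta>>0. \<forall>y\<in>reach_set (\<lambda>x. uminus ` F x) r. norm (y - (\<beta>, \<alpha>)) < \<delta> \<longrightarrow>
      (\<theta>, \<zeta>) \<bullet> (y - (\<beta>, \<alpha>)) \<le> \<epsilon> * norm (y - (\<beta>, \<alpha>))"
    using \<delta>(1) by (intro exI[of _ \<delta>]) auto
qed

lemma inner_ge_of_near:
  fixes u \<theta> w :: "'a::real_inner"
  assumes "norm (u - s *\<^sub>R w) \<le> e * s"
  shows "s * (\<theta> \<bullet> w) - norm \<theta> * (e * s) \<le> \<theta> \<bullet> u"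
proof -
  have "- (\<theta> \<bullet> (u - s *\<^sub>R w)) \<le> norm \<theta> * norm (u - s *\<^sub>R w)"
    using Cauchy_Schwarz_ineq2[of \<theta> "u - s *\<^sub>R w"] by linarith
  also have "\<dots> \<le> norm \<theta> * (e * s)" using assms by (intro mult_left_mono) auto
  finally show ?thesis by (simp add: inner_diff_right)
qed

lemma norm_le_of_near:
  fixes u w :: "'a::real_normed_vector"
  assumes "norm (u - s *\<^sub>R w) \<le> e * s" "0 \<le> s" "e \<le> 1"
  shows "norm u \<le> s * (norm w + 1)"
proof -
  have "e * s \<le> 1 * s" using assms by (intro mult_right_mono) auto
  then show ?thesis
    using norm_triangle_ineq[of "u - s *\<^sub>R w" "s *\<^sub>R w"] assms by (simp add: algebra_simps)
qed

section \<open>Cutting and extending against a normal\<close>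

context lipschitz_inclusion
begin

text \<open>Nearly optimal trajectories from \<open>\<alpha>\<close> to \<open>\<beta>\<close>, of length at most \<open>r + t\<^sup>2\<close>, replace
  an optimal one: dropping their initial piece produces points \<open>x\<close> with \<open>min_time F x \<beta> \<le> r - t\<close>.\<close>

lemma hamiltonian_le_of_descent:
  assumes T: "min_time F \<alpha> \<beta> = ereal r" "0 < r"
    and H: "\<And>\<epsilon>. 0 < \<epsilon> \<Longrightarrow> \<exists>\<delta>>0. \<forall>x t. 0 < t \<longrightarrow> t < \<delta> \<longrightarrow> norm (x - \<alpha>) < \<delta> \<longrightarrow>
      min_time F x \<beta> \<le> ereal (r - t) \<longrightarrow> \<zeta> \<bullet> (x - \<alpha>) - l * t \<le> \<epsilon> * (norm (x - \<alpha>) + t)"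
  shows "hamiltonian F \<alpha> \<zeta> \<le> l"
proof -
  let ?h = "hamiltonian F \<alpha> \<zeta>"
  obtain M where M: "0 \<le> M"
    "\<And>\<epsilon>. 0 < \<epsilon> \<Longrightarrow> \<exists>\<delta>>0. \<forall>x y \<rho> s. norm (x - \<alpha>) < \<delta> \<longrightarrow> 0 \<le> s \<longrightarrow> s < \<delta> \<longrightarrow> 0 \<le> \<rho> \<longrightarrow>
      min_time F x y < ereal (\<rho> + s) \<longrightarrow>
      (\<exists>x' s'. 0 \<le> s' \<and> s' \<le> s \<and> min_time F x y \<le> ereal (\<rho> + s') \<and> min_time F x' y \<le> ereal \<rho> \<and>
        norm (x' - x) \<le> M * s' \<and> (?h - \<epsilon>) * s' \<le> \<zeta> \<bullet> (x' - x))"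
    by (rule cut_initial_piece[of \<alpha> \<zeta>]) blast
  show ?thesis
  proof (rule le_of_le_add_small_multiple)
    fix e :: real assume e: "0 < e" "e < 1"
    obtain \<delta>1 where \<delta>1: "0 < \<delta>1"
      "\<forall>x y \<rho> s. norm (x - \<alpha>) < \<delta>1 \<longrightarrow> 0 \<le> s \<longrightarrow> s < \<delta>1 \<longrightarrow> 0 \<le> \<rho> \<longrightarrow>
      min_time F x y < ereal (\<rho> + s) \<longrightarrow>
      (\<exists>x' s'. 0 \<le> s' \<and> s' \<le> s \<and> min_time F x y \<le> ereal (\<rho> + s') \<and> min_time F x' y \<le> ereal \<rho> \<and>
        norm (x' - x) \<le> M * s' \<and> (?h - e) * s' \<le> \<zeta> \<bullet> (x' - x))"
      using M(2)[OF e(1)] by blast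
    obtain \<delta>2 where \<delta>2: "0 < \<delta>2" "\<forall>x t. 0 < t \<longrightarrow> t < \<delta>2 \<longrightarrow> norm (x - \<alpha>) < \<delta>2 \<longrightarrow>
      min_time F x \<beta> \<le> ereal (r - t) \<longrightarrow> \<zeta> \<bullet> (x - \<alpha>) - l * t \<le> e * (norm (x - \<alpha>) + t)"
      using H[OF e(1)] by blast
    \<comment> \<open>Keeping \<open>t\<close> below \<open>e\<close> gives t * t \<le> t * e,
      keeping it below \<open>r\<close> leaves a nonnegative remaining time; the other terms keep
      the cut and the tested point inside the two neighbourhoods.\<close>
    define \<delta> where "\<delta> = min (min e r) (min (\<delta>1 / 2) (\<delta>2 / (2 * M + 1)))"
    have "0 < \<delta>" using e T(2) \<delta>1(1) \<delta>2(1) M(1) by (simp add: \<delta>_def)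
    then obtain t where t: "0 < t" "t < \<delta>" using dense by blast
    then have t': "t < e" "t < r" "2 * t < \<delta>1" "t < \<delta>2 / (2 * M + 1)" by (auto simp: \<delta>_def)
    have "t * (2 * M + 1) < \<delta>2" using t'(4) M(1) by (simp add: pos_less_divide_eq)
    moreover have "0 \<le> t * (2 * M)" using t M by simp
    ultimately have tM: "2 * M * t < \<delta>2" "t < \<delta>2" using t(1) by (simp_all add: algebra_simps)
    have tt: "0 < t * t" "t * t \<le> t * e" "t * e \<le> t" using t t' e by simp_all
    have "min_time F \<alpha> \<beta> < ereal ((r - t) + (t + t * t))" using T tt by simp
    \<comment> \<open>The cut starts at \<open>\<alpha>\<close> itself. Since
      \<open>min_time F \<alpha> \<beta>\<close> is exactly \<open>r\<close>, at least
      \<open>t\<close> is cut off, so \<open>s\<close> lies between t and t + t * t.\<close>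
    then obtain x s where s: "0 \<le> s" "s \<le> t + t * t" "ereal r \<le> ereal ((r - t) + s)"
      and x: "min_time F x \<beta> \<le> ereal (r - t)" "norm (x - \<alpha>) \<le> M * s" "(?h - e) * s \<le> \<zeta> \<bullet> (x - \<alpha>)"
      using \<delta>1(2)[rule_format, of \<alpha> "t + t * t" "r - t" \<beta>] T \<delta>1(1) t t' tt by auto
    have st: "t \<le> s" "s \<le> 2 * t" using s tt by auto
    have "M * s \<le> M * (2 * t)" using M(1) st by (intro mult_left_mono) auto
    then have xn: "norm (x - \<alpha>) \<le> 2 * M * t" using x(2) by (simp add: mult_ac)
    have "\<zeta> \<bullet> (x - \<alpha>) - l * t \<le> e * (norm (x - \<alpha>) + t)"
      using \<delta>2(2) t(1) tM xn x(1) by (meson le_less_trans)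
    also have "\<dots> \<le> e * (2 * M * t + t)" using xn e by simp
    finally have 1: "(?h - e) * s - l * t \<le> e * (2 * M * t + t)" using x(3) by linarith
    \<comment> \<open>Passage from \<open>s\<close> to \<open>t\<close>: the sign of
      \<open>?h - e\<close> is unknown, but s - t is at most t * t, hence at most t * e.\<close>
    have "\<bar>?h - e\<bar> * (s - t) \<le> (\<bar>?h\<bar> + 1) * (t * e)"
      using st s tt e by (intro mult_mono) auto
    moreover have "- (\<bar>?h - e\<bar> * (s - t)) \<le> (?h - e) * (s - t)"
      using mult_right_mono[of "- \<bar>?h - e\<bar>" "?h - e" "s - t"] st by simp
    moreover have "(?h - e) * s = (?h - e) * (s - t) + (?h - e) * t" by (simp add: algebra_simps)
    ultimately have "(?h - e) * t - (\<bar>?h\<bar> + 1) * (t * e) - l * t \<le> e * (2 * M * t + t)"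
      using 1 by linarith
    then have "t * ?h \<le> t * (l + e * (\<bar>?h\<bar> + 2 * M + 3))" by (simp add: algebra_simps)
    then show "?h \<le> l + e * (\<bar>?h\<bar> + 2 * M + 3)" using t(1) by simp
  qed
qed

text \<open>Descent with \<open>l = 0\<close>: a cut alone already stays in the reachable set. The
  sign obtained here is what later makes the transfer to the epigraph work.\<close>

lemma reach_normal_hamiltonian_nonpos:
  assumes T: "min_time F \<alpha> \<beta> = ereal r" "0 < r"
    and N: "(\<zeta>, \<theta>) \<in> frechet_normal_cone (reach_set F r) (\<alpha>, \<beta>)"
  shows "hamiltonian F \<alpha> \<zeta> \<le> 0"
proof (rule hamiltonian_le_of_descent[OF T])
  fix \<epsilon> :: real assume \<epsilon>: "0 < \<epsilon>"
  obtain \<delta> where \<delta>: "0 < \<delta>"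
    "\<And>x y. min_time F x y \<le> ereal r \<Longrightarrow> norm (x - \<alpha>) + norm (y - \<beta>) < \<delta> \<Longrightarrow>
      \<zeta> \<bullet> (x - \<alpha>) + \<theta> \<bullet> (y - \<beta>) \<le> \<epsilon> * (norm (x - \<alpha>) + norm (y - \<beta>))"
    by (rule reach_set_normalD[OF N \<epsilon>]) blast
  show "\<exists>\<delta>>0. \<forall>x t. 0 < t \<longrightarrow> t < \<delta> \<longrightarrow> norm (x - \<alpha>) < \<delta> \<longrightarrow>
      min_time F x \<beta> \<le> ereal (r - t) \<longrightarrow> \<zeta> \<bullet> (x - \<alpha>) - 0 * t \<le> \<epsilon> * (norm (x - \<alpha>) + t)"
  proof (rule exI[of _ \<delta>], intro conjI allI impI \<delta>(1))
    fix x t assume t: "0 < t" and x: "norm (x - \<alpha>) < \<delta>" "min_time F x \<beta> \<le> ereal (r - t)"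
    have "min_time F x \<beta> \<le> ereal r" using x(2) t by (elim order_trans) simp
    from \<delta>(2)[OF this] x have "\<zeta> \<bullet> (x - \<alpha>) \<le> \<epsilon> * norm (x - \<alpha>)" by simp
    also have "\<dots> \<le> \<epsilon> * (norm (x - \<alpha>) + t)" using t \<epsilon> by simp
    finally show "\<zeta> \<bullet> (x - \<alpha>) - 0 * t \<le> \<epsilon> * (norm (x - \<alpha>) + t)" by simp
  qed
qed

text \<open>Descent with \<open>l\<close> equal to \<open>- (\<theta> \<bullet> w)\<close> for a
  minimising \<open>w\<close>: reaching \<open>\<beta>\<close> in time r - t leaves exactly
  \<open>t\<close> for the extension.\<close>

lemma reach_normal_hamiltonian_le:
  assumes T: "min_time F \<alpha> \<beta> = ereal r" "0 < r"
    and N: "(\<zeta>, \<theta>) \<in> frechet_normal_cone (reach_set F r) (\<alpha>, \<beta>)"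
  shows "hamiltonian F \<alpha> \<zeta> \<le> hamiltonian F \<beta> (- \<theta>)"
proof -
  obtain w where w: "w \<in> F \<beta>" "hamiltonian F \<beta> (- \<theta>) = - (\<theta> \<bullet> w)"
    using hamiltonian_eqE[of \<beta> "- \<theta>"] unfolding inner_minus_left .
  show ?thesis unfolding w(2)
  proof (rule hamiltonian_le_of_descent[OF T])
    fix \<epsilon> :: real assume \<epsilon>: "0 < \<epsilon>"
    \<comment> \<open>Errors per unit of \<open>t\<close>: norm w + 1 from the displacement of
      \<open>y\<close>, norm \<theta> from the deviation of that displacement from
      \<open>t *\<^sub>R w\<close>.\<close>
    define e where "e = min 1 (\<epsilon> / (norm w + norm \<theta> + 1))"
    have den: "0 < norm w + norm \<theta> + 1" using norm_ge_zero[of w] norm_ge_zero[of \<theta>] by linarith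
    have e: "0 < e" "e \<le> 1" using \<epsilon> den by (auto simp: e_def)
    have "e \<le> \<epsilon> / (norm w + norm \<theta> + 1)" by (simp add: e_def)
    then have e': "e * (norm w + norm \<theta> + 1) \<le> \<epsilon>" using den by (simp add: pos_le_divide_eq)
    then have "e * 1 \<le> \<epsilon>" using e by (elim order_trans[rotated]) (intro mult_left_mono, auto)
    then have e\<epsilon>: "e \<le> \<epsilon>" by simp
    obtain \<delta>1 where \<delta>1: "0 < \<delta>1"
      "\<And>x y. min_time F x y \<le> ereal r \<Longrightarrow> norm (x - \<alpha>) + norm (y - \<beta>) < \<delta>1 \<Longrightarrow>
        \<zeta> \<bullet> (x - \<alpha>) + \<theta> \<bullet> (y - \<beta>) \<le> e * (norm (x - \<alpha>) + norm (y - \<beta>))"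
      by (rule reach_set_normalD[OF N e(1)]) blast
    obtain \<delta>2 where \<delta>2: "0 < \<delta>2"
      "\<And>y \<tau>. norm (y - \<beta>) < \<delta>2 \<Longrightarrow> 0 \<le> \<tau> \<Longrightarrow> \<tau> < \<delta>2 \<Longrightarrow>
        \<exists>y'. norm (y' - y - \<tau> *\<^sub>R w) \<le> e * \<tau> \<and> min_time F y y' \<le> ereal \<tau>"
      by (rule reachable_in_direction[OF w(1) e(1)]) blast
    define \<delta> where "\<delta> = min \<delta>2 (\<delta>1 / (norm w + 2))"
    have w2: "0 < norm w + 2" using norm_ge_zero[of w] by linarith
    have \<delta>: "0 < \<delta>" "\<delta> \<le> \<delta>2" "\<delta> * (norm w + 2) \<le> \<delta>1"
      using \<delta>1(1) \<delta>2(1) w2 by (auto simp: \<delta>_def pos_le_divide_eq[symmetric])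
    show "\<exists>\<delta>>0. \<forall>x t. 0 < t \<longrightarrow> t < \<delta> \<longrightarrow> norm (x - \<alpha>) < \<delta> \<longrightarrow> min_time F x \<beta> \<le> ereal (r - t) \<longrightarrow>
        \<zeta> \<bullet> (x - \<alpha>) - - (\<theta> \<bullet> w) * t \<le> \<epsilon> * (norm (x - \<alpha>) + t)"
    proof (rule exI[of _ \<delta>], intro conjI allI impI \<delta>(1))
      fix x t assume t: "0 < t" "t < \<delta>" and x: "norm (x - \<alpha>) < \<delta>" "min_time F x \<beta> \<le> ereal (r - t)"
      obtain y where y: "norm (y - \<beta> - t *\<^sub>R w) \<le> e * t" "min_time F \<beta> y \<le> ereal t"
        using \<delta>2(2)[of \<beta> t] \<delta>2(1) t \<delta>(2) by auto
      have Ty: "min_time F x y \<le> ereal r" using min_time_triangle[OF x(2) y(2)] by simp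
      have yn: "norm (y - \<beta>) \<le> t * (norm w + 1)" using norm_le_of_near[OF y(1)] t e by simp
      moreover have "t * (norm w + 1) \<le> \<delta> * (norm w + 1)" using t by (intro mult_right_mono) auto
      ultimately have "norm (x - \<alpha>) + norm (y - \<beta>) < \<delta>1" using x(1) \<delta>(3) by (simp add: algebra_simps)
      from \<delta>1(2)[OF Ty this]
      have "\<zeta> \<bullet> (x - \<alpha>) + \<theta> \<bullet> (y - \<beta>) \<le> e * (norm (x - \<alpha>) + norm (y - \<beta>))" .
      also have "\<dots> \<le> e * (norm (x - \<alpha>) + t * (norm w + 1))" using yn e by simp
      finally have "\<zeta> \<bullet> (x - \<alpha>) + t * (\<theta> \<bullet> w) \<le> e * norm (x - \<alpha>) + t * (e * (norm w + norm \<theta> + 1))"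
        using inner_ge_of_near[OF y(1), of \<theta>] by (simp add: algebra_simps)
      also have "\<dots> \<le> \<epsilon> * norm (x - \<alpha>) + t * \<epsilon>"
        using e\<epsilon> e' t by (intro add_mono mult_right_mono mult_left_mono) auto
      finally show "\<zeta> \<bullet> (x - \<alpha>) - - (\<theta> \<bullet> w) * t \<le> \<epsilon> * (norm (x - \<alpha>) + t)"
        by (simp add: algebra_simps)
    qed
  qed
qed

lemma reach_normal_hamiltonian_eq:
  assumes T: "min_time F \<alpha> \<beta> = ereal r" "0 < r"
    and N: "(\<zeta>, \<theta>) \<in> frechet_normal_cone (reach_set F r) (\<alpha>, \<beta>)"
  shows "hamiltonian F \<alpha> \<zeta> = hamiltonian F \<beta> (- \<theta>)"
proof (rule antisym)
  interpret rev: lipschitz_inclusion "\<lambda>x. uminus ` F x" by (rule reverse)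
  show "hamiltonian F \<beta> (- \<theta>) \<le> hamiltonian F \<alpha> \<zeta>"
    using rev.reach_normal_hamiltonian_le[of \<beta> \<alpha> r \<theta> \<zeta>] T reach_set_normal_reverse[OF N]
    by (simp add: min_time_reverse hamiltonian_reverse)
qed (rule reach_normal_hamiltonian_le[OF T N])

text \<open>A height \<mu> \<le> r leaves time r - \<mu> for an extension, a greater one calls for a
  cut; either way the modified pair lies in the reachable set. Extensions yield the slope
  \<open>- (\<theta> \<bullet> w)\<close>, cuts yield \<open>hamiltonian F \<alpha> \<zeta>\<close>,
  and these agree.\<close>

lemma epi_normal_of_reach_normal:
  assumes T: "min_time F \<alpha> \<beta> = ereal r" "0 < r"
    and N: "(\<zeta>, \<theta>) \<in> frechet_normal_cone (reach_set F r) (\<alpha>, \<beta>)"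
  shows "((\<zeta>, \<theta>), hamiltonian F \<alpha> \<zeta>) \<in> frechet_normal_cone (epi_min_time F) ((\<alpha>, \<beta>), r)"
  unfolding frechet_normal_cone_def
proof (intro CollectI allI impI)
  fix \<epsilon> :: real assume \<epsilon>: "0 < \<epsilon>"
  define h where "h = hamiltonian F \<alpha> \<zeta>"
  have h0: "h \<le> 0" unfolding h_def by (rule reach_normal_hamiltonian_nonpos[OF T N])
  obtain w where w: "w \<in> F \<beta>" "h = - (\<theta> \<bullet> w)"
    using hamiltonian_eqE[of \<beta> "- \<theta>"]
    unfolding h_def reach_normal_hamiltonian_eq[OF T N] inner_minus_left .
  obtain M where M: "0 \<le> M"
    "\<And>\<epsilon>. 0 < \<epsilon> \<Longrightarrow> \<exists>\<delta>>0. \<forall>x y \<rho> s. norm (x - \<alpha>) < \<delta> \<longrightarrow> 0 \<le> s \<longrightarrow> s < \<delta> \<longrightarrow> 0 \<le> \<rho> \<longrightarrow>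
      min_time F x y < ereal (\<rho> + s) \<longrightarrow>
      (\<exists>x' s'. 0 \<le> s' \<and> s' \<le> s \<and> min_time F x y \<le> ereal (\<rho> + s') \<and> min_time F x' y \<le> ereal \<rho> \<and>
        norm (x' - x) \<le> M * s' \<and> (h - \<epsilon>) * s' \<le> \<zeta> \<bullet> (x' - x))"
    unfolding h_def by (rule cut_initial_piece[of \<alpha> \<zeta>]) blast
  \<comment> \<open>\<open>C\<close> dominates every factor produced below: the displacement factors
    norm w + 3 and 2 * M + 2, and the final error factors of the two cases.\<close>
  define C where "C = 4 + norm w + norm \<theta> + 2 * M + \<bar>h\<bar>"
  have C: "0 < C" "2 * M + 2 \<le> C" "norm w + 3 \<le> C" "3 + norm w + norm \<theta> \<le> C" "4 + 2 * M + \<bar>h\<bar> \<le> C"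
    unfolding C_def using M(1) norm_ge_zero[of w] norm_ge_zero[of \<theta>] abs_ge_zero[of h] by linarith+
  define e where "e = min 1 (\<epsilon> / C)"
  have e: "0 < e" "e \<le> 1" "e * C \<le> \<epsilon>" using \<epsilon> C(1) by (auto simp: e_def pos_le_divide_eq[symmetric])
  obtain \<delta>1 where \<delta>1: "0 < \<delta>1"
    "\<And>x y. min_time F x y \<le> ereal r \<Longrightarrow> norm (x - \<alpha>) + norm (y - \<beta>) < \<delta>1 \<Longrightarrow>
      \<zeta> \<bullet> (x - \<alpha>) + \<theta> \<bullet> (y - \<beta>) \<le> e * (norm (x - \<alpha>) + norm (y - \<beta>))"
    by (rule reach_set_normalD[OF N e(1)]) blast
  obtain \<delta>2 where \<delta>2: "0 < \<delta>2"
    "\<And>y \<tau>. norm (y - \<beta>) < \<delta>2 \<Longrightarrow> 0 \<le> \<tau> \<Longrightarrow> \<tau> < \<delta>2 \<Longrightarrow>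
      \<exists>y'. norm (y' - y - \<tau> *\<^sub>R w) \<le> e * \<tau> \<and> min_time F y y' \<le> ereal \<tau>"
    by (rule reachable_in_direction[OF w(1) e(1)]) blast
  obtain \<delta>3 where \<delta>3: "0 < \<delta>3"
    "\<forall>x y \<rho> s. norm (x - \<alpha>) < \<delta>3 \<longrightarrow> 0 \<le> s \<longrightarrow> s < \<delta>3 \<longrightarrow> 0 \<le> \<rho> \<longrightarrow>
      min_time F x y < ereal (\<rho> + s) \<longrightarrow>
      (\<exists>x' s'. 0 \<le> s' \<and> s' \<le> s \<and> min_time F x y \<le> ereal (\<rho> + s') \<and> min_time F x' y \<le> ereal \<rho> \<and>
        norm (x' - x) \<le> M * s' \<and> (h - e) * s' \<le> \<zeta> \<bullet> (x' - x))"
    using M(2)[OF e(1)] by blast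
  define \<delta> where "\<delta> = min (min e \<delta>2) (min (\<delta>3 / 2) (\<delta>1 / C))"
  have "0 < \<delta>1 / C" using \<delta>1(1) C(1) by simp
  then have \<delta>: "0 < \<delta>" "\<delta> \<le> e" "\<delta> \<le> \<delta>2" "\<delta> \<le> \<delta>3 / 2" and "\<delta> \<le> \<delta>1 / C"
    unfolding \<delta>_def using e(1) \<delta>2(1) \<delta>3(1) by linarith+
  then have \<delta>C: "\<delta> * C \<le> \<delta>1" using C(1) by (simp only: pos_le_divide_eq)
  \<comment> \<open>Stated with a common bound \<open>n\<close> for the three components; in the end
    \<open>n\<close> is the Euclidean norm of the whole displacement, which dominates each of
    them.\<close>
  have main: "\<zeta> \<bullet> (x - \<alpha>) + \<theta> \<bullet> (y - \<beta>) + h * (\<mu> - r) \<le> e * (n * C)"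
    if Txy: "min_time F x y \<le> ereal \<mu>"
      and n: "norm (x - \<alpha>) \<le> n" "norm (y - \<beta>) \<le> n" "\<bar>\<mu> - r\<bar> \<le> n" "n < \<delta>" for x y \<mu> n
  proof -
    have n0: "0 \<le> n" using n(3) abs_ge_zero order_trans by blast
    have nC: "n * C < \<delta>1" using mult_strict_right_mono[OF n(4) C(1)] \<delta>C by linarith
    have nle: "n * a \<le> n * C" if "a \<le> C" for a using that n0 by (rule mult_left_mono)
    show ?thesis
    proof (cases "\<mu> \<le> r")
      case True
      define s where "s = r - \<mu>"
      have s: "0 \<le> s" "s \<le> n" using True n(3) by (auto simp: s_def)
      obtain y' where y': "norm (y' - y - s *\<^sub>R w) \<le> e * s" "min_time F y y' \<le> ereal s"
        using \<delta>2(2)[of y s] s n \<delta> by force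
      have Ty: "min_time F x y' \<le> ereal r" using min_time_triangle[OF Txy y'(2)] by (simp add: s_def)
      have "norm (y' - y) \<le> s * (norm w + 1)" using norm_le_of_near[OF y'(1)] s e by simp
      also have "\<dots> \<le> n * (norm w + 1)" using s by (intro mult_right_mono) auto
      finally have "norm (x - \<alpha>) + norm (y' - \<beta>) \<le> n * (norm w + 3)"
        using n norm_triangle_ineq[of "y' - y" "y - \<beta>"] by (simp add: algebra_simps)
      moreover have "n * (norm w + 3) < \<delta>1" using nle[OF C(3)] nC by linarith
      ultimately have "\<zeta> \<bullet> (x - \<alpha>) + \<theta> \<bullet> (y' - \<beta>) \<le> e * (norm (x - \<alpha>) + norm (y' - \<beta>))"
        and "e * (norm (x - \<alpha>) + norm (y' - \<beta>)) \<le> e * (n * (norm w + 3))"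
        using \<delta>1(2)[OF Ty] e by auto
      moreover have "s * (\<theta> \<bullet> w) - norm \<theta> * (e * s) \<le> \<theta> \<bullet> (y' - y)"
        by (rule inner_ge_of_near[OF y'(1)])
      moreover have "norm \<theta> * (e * s) \<le> norm \<theta> * (e * n)" using s e by (intro mult_left_mono) auto
      moreover have "\<theta> \<bullet> (y' - \<beta>) = \<theta> \<bullet> (y' - y) + \<theta> \<bullet> (y - \<beta>)" by (simp add: inner_diff_right)
      moreover have "h * (\<mu> - r) = s * (\<theta> \<bullet> w)" by (simp add: w(2) s_def algebra_simps)
      ultimately have "\<zeta> \<bullet> (x - \<alpha>) + \<theta> \<bullet> (y - \<beta>) + h * (\<mu> - r) \<le>
          e * (n * (norm w + 3)) + norm \<theta> * (e * n)" by linarith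
      also have "\<dots> = e * (n * (3 + norm w + norm \<theta>))" by (simp add: algebra_simps)
      also have "\<dots> \<le> e * (n * C)" using nle[OF C(4)] e by simp
      finally show ?thesis .
    next
      case False
      define \<tau> where "\<tau> = \<mu> - r"
      \<comment> \<open>The term \<tau> * \<tau> makes the bound on \<open>min_time\<close> strict,
        as the cut requires; since \<tau> < e, it is of size e * n only.\<close>
      define s where "s = \<tau> + \<tau> * \<tau>"
      have \<tau>: "0 < \<tau>" "\<tau> \<le> n" using False n(3) by (auto simp: \<tau>_def)
      have \<tau>2: "\<tau> * \<tau> \<le> e * n" "0 < \<tau> * \<tau>"
        using \<tau> n(4) \<delta>(2) n0 e(1) by (auto intro!: mult_mono)
      have "e * n \<le> 1 * n" using n0 e(2) by (rule mult_right_mono[rotated])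
      then have s: "0 \<le> s" "s \<le> 2 * n" unfolding s_def using \<tau> \<tau>2 by linarith+
      have "min_time F x y < ereal (r + s)"
        using Txy \<tau>2(2) by (elim le_less_trans) (simp add: s_def \<tau>_def)
      then obtain x' s' where x': "0 \<le> s'" "s' \<le> s" "min_time F x' y \<le> ereal r"
          "norm (x' - x) \<le> M * s'" "(h - e) * s' \<le> \<zeta> \<bullet> (x' - x)"
        using \<delta>3(2)[rule_format, of x s r y] s n \<delta> T(2) by force
      have "M * s' \<le> M * (2 * n)" using M(1) x' s by (intro mult_left_mono) auto
      then have "norm (x' - \<alpha>) + norm (y - \<beta>) \<le> n * (2 * M + 2)"
        using x'(4) n norm_triangle_ineq[of "x' - x" "x - \<alpha>"] by (simp add: algebra_simps)
      moreover have "n * (2 * M + 2) < \<delta>1" using nle[OF C(2)] nC by linarith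
      ultimately have "\<zeta> \<bullet> (x' - \<alpha>) + \<theta> \<bullet> (y - \<beta>) \<le> e * (norm (x' - \<alpha>) + norm (y - \<beta>))"
        and "e * (norm (x' - \<alpha>) + norm (y - \<beta>)) \<le> e * (n * (2 * M + 2))"
        using \<delta>1(2)[OF x'(3)] e by auto
      \<comment> \<open>\<open>min_time F x y\<close> may be far below \<mu>, so the cut may be
        short and only s' \<le> s is available. Because h \<le> 0, this is the direction
        required.\<close>
      moreover have "(h - e) * s \<le> (h - e) * s'" using x'(2) h0 e by (intro mult_left_mono_neg) auto
      moreover have "(h - e) * s = h * \<tau> + h * (\<tau> * \<tau>) - e * s" by (simp add: s_def algebra_simps)
      moreover have "- (\<bar>h\<bar> * (e * n)) \<le> h * (\<tau> * \<tau>)"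
        using mult_left_mono_neg[OF \<tau>2(1) h0] h0 by simp
      moreover have "e * s \<le> e * (2 * n)" using s e by simp
      moreover have "\<zeta> \<bullet> (x' - \<alpha>) = \<zeta> \<bullet> (x' - x) + \<zeta> \<bullet> (x - \<alpha>)" by (simp add: inner_diff_right)
      ultimately have "\<zeta> \<bullet> (x - \<alpha>) + \<theta> \<bullet> (y - \<beta>) + h * \<tau> \<le>
          e * (n * (2 * M + 2)) + \<bar>h\<bar> * (e * n) + e * (2 * n)" using x'(5) by linarith
      also have "\<dots> = e * (n * (4 + 2 * M + \<bar>h\<bar>))" by (simp add: algebra_simps)
      also have "\<dots> \<le> e * (n * C)" using nle[OF C(5)] e by simp
      finally show ?thesis by (simp add: \<tau>_def)
    qed
  qed
  show "\<exists>\<delta>>0. \<forall>z\<in>epi_min_time F. norm (z - ((\<alpha>, \<beta>), r)) < \<delta> \<longrightarrow>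
      ((\<zeta>, \<theta>), hamiltonian F \<alpha> \<zeta>) \<bullet> (z - ((\<alpha>, \<beta>), r)) \<le> \<epsilon> * norm (z - ((\<alpha>, \<beta>), r))"
  proof (rule exI[of _ \<delta>], intro conjI ballI impI \<delta>(1))
    fix z assume z: "z \<in> epi_min_time F" "norm (z - ((\<alpha>, \<beta>), r)) < \<delta>"
    obtain x y \<mu> where xy: "z = ((x, y), \<mu>)" by (metis surj_pair)
    define n where "n = norm (z - ((\<alpha>, \<beta>), r))"
    have nn: "norm (x - \<alpha>, y - \<beta>) \<le> n" "\<bar>\<mu> - r\<bar> \<le> n"
      using norm_fst_le[of "(x - \<alpha>, y - \<beta>)" "\<mu> - r"] norm_snd_le[of "\<mu> - r" "(x - \<alpha>, y - \<beta>)"]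
      by (simp_all add: n_def xy)
    then have nn': "norm (x - \<alpha>) \<le> n" "norm (y - \<beta>) \<le> n"
      using norm_fst_le[of "x - \<alpha>" "y - \<beta>"] norm_snd_le[of "y - \<beta>" "x - \<alpha>"] by linarith+
    have "min_time F x y \<le> ereal \<mu>" using z(1) by (simp add: xy epi_min_time_def)
    from main[OF this nn' nn(2)] z(2)
    have "\<zeta> \<bullet> (x - \<alpha>) + \<theta> \<bullet> (y - \<beta>) + h * (\<mu> - r) \<le> n * (e * C)" by (simp add: n_def mult_ac)
    also have "\<dots> \<le> n * \<epsilon>" using e(3) by (intro mult_left_mono) (auto simp: n_def)
    finally show "((\<zeta>, \<theta>), hamiltonian F \<alpha> \<zeta>) \<bullet> (z - ((\<alpha>, \<beta>), r)) \<le> \<epsilon> * norm (z - ((\<alpha>, \<beta>), r))"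
      unfolding n_def[symmetric] by (simp add: xy h_def[symmetric] mult.commute)
  qed
qed

text \<open>Upper bound: points with time r - t to \<open>\<beta>\<close> give epigraph points at
  height r - t, so descent applies with slope \<open>l\<close>. Lower bound: an extension past
  \<open>\<beta>\<close> raises the height by \<open>t\<close> and gives
  \<open>l \<le> hamiltonian F \<beta> (- \<theta>)\<close>, which the equality for reachable-set
  normals moves to \<open>\<alpha>\<close>.\<close>

lemma epi_normal_hamiltonian_eq:
  assumes T: "min_time F \<alpha> \<beta> = ereal r" "0 < r"
    and N: "((\<zeta>, \<theta>), l) \<in> frechet_normal_cone (epi_min_time F) ((\<alpha>, \<beta>), r)"
  shows "hamiltonian F \<alpha> \<zeta> = l"
proof (rule antisym)
  show "hamiltonian F \<alpha> \<zeta> \<le> l"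
  proof (rule hamiltonian_le_of_descent[OF T])
    fix \<epsilon> :: real assume \<epsilon>: "0 < \<epsilon>"
    obtain \<delta> where \<delta>: "0 < \<delta>"
      "\<And>x y \<mu>. min_time F x y \<le> ereal \<mu> \<Longrightarrow> norm (x - \<alpha>) + norm (y - \<beta>) + \<bar>\<mu> - r\<bar> < \<delta> \<Longrightarrow>
        \<zeta> \<bullet> (x - \<alpha>) + \<theta> \<bullet> (y - \<beta>) + l * (\<mu> - r) \<le> \<epsilon> * (norm (x - \<alpha>) + norm (y - \<beta>) + \<bar>\<mu> - r\<bar>)"
      by (rule epi_min_time_normalD[OF N \<epsilon>]) blast
    show "\<exists>\<delta>>0. \<forall>x t. 0 < t \<longrightarrow> t < \<delta> \<longrightarrow> norm (x - \<alpha>) < \<delta> \<longrightarrow>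
        min_time F x \<beta> \<le> ereal (r - t) \<longrightarrow> \<zeta> \<bullet> (x - \<alpha>) - l * t \<le> \<epsilon> * (norm (x - \<alpha>) + t)"
    proof (rule exI[of _ "\<delta> / 2"], intro conjI allI impI)
      fix x t assume "0 < t" "t < \<delta> / 2" "norm (x - \<alpha>) < \<delta> / 2" "min_time F x \<beta> \<le> ereal (r - t)"
      then show "\<zeta> \<bullet> (x - \<alpha>) - l * t \<le> \<epsilon> * (norm (x - \<alpha>) + t)"
        using \<delta>(2)[of x \<beta> "r - t"] by simp
    qed (use \<delta>(1) in simp)
  qed
next
  obtain w where w: "w \<in> F \<beta>" "hamiltonian F \<beta> (- \<theta>) = - (\<theta> \<bullet> w)"
    using hamiltonian_eqE[of \<beta> "- \<theta>"] unfolding inner_minus_left .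
  have "l \<le> - (\<theta> \<bullet> w)"
  proof (rule le_of_le_add_small_multiple)
    fix e :: real assume e: "0 < e" "e < 1"
    obtain \<delta>1 where \<delta>1: "0 < \<delta>1"
      "\<And>x y \<mu>. min_time F x y \<le> ereal \<mu> \<Longrightarrow> norm (x - \<alpha>) + norm (y - \<beta>) + \<bar>\<mu> - r\<bar> < \<delta>1 \<Longrightarrow>
        \<zeta> \<bullet> (x - \<alpha>) + \<theta> \<bullet> (y - \<beta>) + l * (\<mu> - r) \<le> e * (norm (x - \<alpha>) + norm (y - \<beta>) + \<bar>\<mu> - r\<bar>)"
      by (rule epi_min_time_normalD[OF N e(1)]) blast
    obtain \<delta>2 where \<delta>2: "0 < \<delta>2"
      "\<And>y \<tau>. norm (y - \<beta>) < \<delta>2 \<Longrightarrow> 0 \<le> \<tau> \<Longrightarrow> \<tau> < \<delta>2 \<Longrightarrow>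
        \<exists>y'. norm (y' - y - \<tau> *\<^sub>R w) \<le> e * \<tau> \<and> min_time F y y' \<le> ereal \<tau>"
      by (rule reachable_in_direction[OF w(1) e(1)]) blast
    have w2: "0 < norm w + 2" using norm_ge_zero[of w] by linarith
    have "0 < min \<delta>2 (\<delta>1 / (norm w + 2))" using \<delta>1(1) \<delta>2(1) w2 by simp
    then obtain t where t: "0 < t" "t < min \<delta>2 (\<delta>1 / (norm w + 2))" using dense by blast
    then have t': "t * (norm w + 2) < \<delta>1" using w2 by (simp add: pos_less_divide_eq)
    obtain y where y: "norm (y - \<beta> - t *\<^sub>R w) \<le> e * t" "min_time F \<beta> y \<le> ereal t"
      using \<delta>2(2)[of \<beta> t] \<delta>2(1) t by auto
    have Ty: "min_time F \<alpha> y \<le> ereal (r + t)" using min_time_triangle[OF _ y(2)] T(1) by simp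
    have yn: "norm (y - \<beta>) \<le> t * (norm w + 1)" using norm_le_of_near[OF y(1)] t e by simp
    then have "norm (\<alpha> - \<alpha>) + norm (y - \<beta>) + \<bar>r + t - r\<bar> < \<delta>1" using t t' by (simp add: algebra_simps)
    from \<delta>1(2)[OF Ty this] have "\<theta> \<bullet> (y - \<beta>) + l * t \<le> e * (norm (y - \<beta>) + t)" using t by simp
    also have "\<dots> \<le> e * (t * (norm w + 1) + t)" using yn e by simp
    finally have "t * l \<le> t * (- (\<theta> \<bullet> w) + e * (norm w + norm \<theta> + 2))"
      using inner_ge_of_near[OF y(1), of \<theta>] by (simp add: algebra_simps)
    then show "l \<le> - (\<theta> \<bullet> w) + e * (norm w + norm \<theta> + 2)" using t(1) by simp
  qed
  then show "l \<le> hamiltonian F \<alpha> \<zeta>"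
    using reach_normal_hamiltonian_eq[OF T reach_set_normal_of_epi_normal[OF N]] w(2) by simp
qed

end

theorem theorem3p6:
  fixes F :: "real ^ 'n \<Rightarrow> (real ^ 'n) set"
    and \<alpha> \<beta> :: "real ^ 'n"
    and r :: real
  assumes F1: "\<And>x. F x \<noteq> {} \<and> compact (F x) \<and> convex (F x)"
    and F2: "\<And>K. compact K \<Longrightarrow>
      \<exists>L::real. \<forall>x\<in>K. \<forall>y\<in>K. F x \<subseteq> {w + (L * norm (y - x)) *\<^sub>R b | w b. w \<in> F y \<and> b \<in> cball 0 1}"
    and F3: "\<exists>\<gamma> c :: real. \<gamma> > 0 \<and> c > 0 \<and> (\<forall>x. \<forall>v\<in>F x. norm v \<le> \<gamma> * norm x + c)"
    and r: "min_time F \<alpha> \<beta> = ereal r" "0 < r"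
  shows "(\<forall>\<zeta> \<theta>. (\<zeta>, \<theta>) \<in> frechet_normal_cone (reach_set F r) (\<alpha>, \<beta>) \<longrightarrow>
            hamiltonian F \<alpha> \<zeta> = hamiltonian F \<beta> (- \<theta>) \<and>
            ((\<zeta>, \<theta>), hamiltonian F \<alpha> \<zeta>) \<in> frechet_normal_cone (epi_min_time F) ((\<alpha>, \<beta>), r))
       \<and> (\<forall>\<zeta> \<theta> l. ((\<zeta>, \<theta>), l) \<in> frechet_normal_cone (epi_min_time F) ((\<alpha>, \<beta>), r) \<longrightarrow>
            l \<le> 0 \<and> hamiltonian F \<alpha> \<zeta> = l \<and> hamiltonian F \<beta> (- \<theta>) = l \<and>
            (\<zeta>, \<theta>) \<in> frechet_normal_cone (reach_set F r) (\<alpha>, \<beta>))"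
proof -
  interpret lipschitz_inclusion F
  proof
    fix K :: "(real ^ 'n) set" assume K: "compact K"
    obtain L :: real where L: "\<forall>x\<in>K. \<forall>y\<in>K.
        F x \<subseteq> {w + (L * norm (y - x)) *\<^sub>R b | w b. w \<in> F y \<and> b \<in> cball 0 1}"
      using F2[OF K] by (elim exE)
    show "\<exists>L. \<forall>x\<in>K. \<forall>y\<in>K. \<forall>v\<in>F x. \<exists>w\<in>F y. norm (v - w) \<le> L * norm (x - y)"
    \<comment> \<open>The sign of the constant in \<open>F2\<close> is left open, hence the absolute
      value.\<close>
    proof (intro exI[of _ "\<bar>L\<bar>"] ballI)
      fix x y v assume "x \<in> K" "y \<in> K" "v \<in> F x"
      then have "v \<in> {w + (L * norm (y - x)) *\<^sub>R b | w b. w \<in> F y \<and> b \<in> cball 0 1}"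
        using L by (meson subsetD)
      then obtain w b where w: "w \<in> F y" "norm b \<le> 1" "v = w + (L * norm (y - x)) *\<^sub>R b"
        by (auto simp: dist_norm)
      have "norm (v - w) = \<bar>L\<bar> * norm (y - x) * norm b" by (simp add: w(3) abs_mult)
      also have "\<dots> \<le> \<bar>L\<bar> * norm (x - y)"
        using w(2) by (simp add: mult_left_le norm_minus_commute)
      finally show "\<exists>w\<in>F y. norm (v - w) \<le> \<bar>L\<bar> * norm (x - y)" using w(1) by blast
    qed
  qed (use F1 in auto)
  show ?thesis
  proof (intro conjI allI impI)
    fix \<zeta> \<theta> l
    assume N: "((\<zeta>, \<theta>), l) \<in> frechet_normal_cone (epi_min_time F) ((\<alpha>, \<beta>), r)"
    note N' = reach_set_normal_of_epi_normal[OF N]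
    show "l \<le> 0" by (rule epi_normal_nonpos[OF r(1) N])
    show "hamiltonian F \<alpha> \<zeta> = l" by (rule epi_normal_hamiltonian_eq[OF r N])
    then show "hamiltonian F \<beta> (- \<theta>) = l" using reach_normal_hamiltonian_eq[OF r N'] by simp
    show "(\<zeta>, \<theta>) \<in> frechet_normal_cone (reach_set F r) (\<alpha>, \<beta>)" by (rule N')
  qed (fact reach_normal_hamiltonian_eq[OF r] epi_normal_of_reach_normal[OF r])+
qed

end
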